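(* Let $(E,T,S,e)$ be a conditional expectation preserving system with $T$ strictly positive. If $(E,T,S,e)$ is (conditionally) weakly mixing, then $(E,T,S,e)$ is ergodic.
   Context: Let $E$ be a Riesz space with weak order unit. A conditional expectation operator on $E$ is a positive order continuous projection $T\colon E\to E$ whose range $R(T)$ is a Dedekind complete Riesz subspace of $E$ and such that $Tu$ is a weak order unit of $E$ for each weak order unit $u$ of $E$. A conditional expectation preserving system $(E,T,S,e)$ consists of a Dedekind complete Riesz space $E$ with weak order unit $e$, a conditional expectation operator $T$ on $E$ with $Te=e$, and an order continuous Riesz homomorphism $S\colon E\to E$ with $Se=e$, such that $TSPe=TPe$ for all band projections $P$ on $E$ (equivalently, $TSf=Tf$ for all $f\in E$). For $f\in E$ and $n\in\mathbb{N}$ put $S_nf=\frac1n\sum_{k=0}^{n-1}S^kf$ and $L_Sf=\lim_{n\to\infty}S_nf$ (order limit in $E$) whenever it exists. Let $\mathcal{I}_S=\{f\in E: Sf=f\}$; for $f\in\mathcal{I}_S$ the limit $L_Sf$ exists. The system is ergodic if $L_Sf\in R(T)$ for all $f\in\mathcal{I}_S$. $T$ is strictly positive if $T$ is a positive operator and, for $f\ge 0$, $Tf=0$ if and only if $f=0$. $E_e=\{f\in E: |f|\le ke \text{ for some } k\in\mathbb{R}_+\}$ is an $f$-algebra with the multiplication $\cdot$ determined by $Pe\cdot Qe=PQe$ for all band projections $P,Q$ on $E$, extended to $E_e$ by linearity and order limits (so $e$ is the multiplicative unit). $T$ and $S$ map $E_e$ into itself. The system is (conditionally) weakly mixing if,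 for all band projections $P$ and $Q$ on $E$, $$\frac1n\sum_{k=0}^{n-1}\left|T\big((S^kPe)\cdot Qe\big)-TPe\cdot TQe\right|\to 0$$ in order as $n\to\infty$. *)

theory Defs
  imports Complex_Main "HOL-Library.Lattice_Algebras"
begin

class dedekind_complete_riesz_space =
  lattice_ab_group_add_abs + ordered_real_vector + conditionally_complete_lattice

section \<open>Order convergence and order continuity\<close>

text \<open>In the following definitions every set whose infimum is taken consists of nonnegative
  elements, so that \<^const>\<open>Inf\<close> is its actual infimum.\<close>

definition order_tendsto ::
    "(nat \<Rightarrow> 'a::dedekind_complete_riesz_space) \<Rightarrow> 'a \<Rightarrow> bool" where
  "order_tendsto X x \<longleftrightarrow>
     (\<exists>v. decseq v \<and> (\<forall>n. \<bar>X n - x\<bar> \<le> v n) \<and> (INF n. v n) = 0)"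

definition downward_to_zero :: "'a::dedekind_complete_riesz_space set \<Rightarrow> bool" where
  "downward_to_zero D \<longleftrightarrow>
     D \<noteq> {} \<and> (\<forall>f\<in>D. 0 \<le> f) \<and> (\<forall>f\<in>D. \<forall>g\<in>D. \<exists>h\<in>D. h \<le> f \<and> h \<le> g) \<and> Inf D = 0"

definition order_continuous ::
    "('a::dedekind_complete_riesz_space \<Rightarrow> 'a) \<Rightarrow> bool" where
  "order_continuous T \<longleftrightarrow>
     (\<forall>D. downward_to_zero D \<longrightarrow> (INF f\<in>D. \<bar>T f\<bar>) = 0)"

section \<open>Riesz subspaces, bands and band projections\<close>

definition riesz_subspace :: "'a::dedekind_complete_riesz_space set \<Rightarrow> bool" where
  "riesz_subspace R \<longleftrightarrow>
     subspace R \<and> (\<forall>f\<in>R. \<forall>g\<in>R. sup f g \<in> R \<and> inf f g \<in> R)"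

text \<open>Completeness of \<open>R\<close> as an ordered set in its own right: bounds and suprema are taken
  within \<open>R\<close>.\<close>

definition dedekind_complete_set :: "'a::order set \<Rightarrow> bool" where
  "dedekind_complete_set R \<longleftrightarrow>
     (\<forall>A. A \<subseteq> R \<and> A \<noteq> {} \<and> (\<exists>u\<in>R. \<forall>a\<in>A. a \<le> u) \<longrightarrow>
        (\<exists>s\<in>R. (\<forall>a\<in>A. a \<le> s) \<and> (\<forall>u\<in>R. (\<forall>a\<in>A. a \<le> u) \<longrightarrow> s \<le> u)))"

definition riesz_ideal :: "'a::dedekind_complete_riesz_space set \<Rightarrow> bool" where
  "riesz_ideal B \<longleftrightarrow> subspace B \<and> (\<forall>f g. g \<in> B \<and> \<bar>f\<bar> \<le> \<bar>g\<bar> \<longrightarrow> f \<in> B)"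

definition riesz_band :: "'a::dedekind_complete_riesz_space set \<Rightarrow> bool" where
  "riesz_band B \<longleftrightarrow>
     riesz_ideal B \<and> (\<forall>D. D \<subseteq> B \<and> D \<noteq> {} \<and> bdd_above D \<longrightarrow> Sup D \<in> B)"

definition disjoint_complement ::
    "'a::dedekind_complete_riesz_space set \<Rightarrow> 'a set" where
  "disjoint_complement B = {f. \<forall>g\<in>B. inf \<bar>f\<bar> \<bar>g\<bar> = 0}"

text \<open>\<open>P\<close> is the projection onto a band \<open>B\<close> along its disjoint complement; linearity and
  idempotence follow from the uniqueness of the decomposition.\<close>

definition band_projection ::
    "('a::dedekind_complete_riesz_space \<Rightarrow> 'a) \<Rightarrow> bool" where
  "band_projection P \<longleftrightarrow>
     (\<exists>B. riesz_band B \<and> (\<forall>f. P f \<in> B \<and> f - P f \<in> disjoint_complement B))"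

definition weak_order_unit :: "'a::dedekind_complete_riesz_space \<Rightarrow> bool" where
  "weak_order_unit u \<longleftrightarrow> 0 \<le> u \<and> (\<forall>f. inf \<bar>f\<bar> u = 0 \<longrightarrow> f = 0)"

section \<open>Conditional expectation preserving systems\<close>

definition positive_operator ::
    "('a::dedekind_complete_riesz_space \<Rightarrow> 'a) \<Rightarrow> bool" where
  "positive_operator T \<longleftrightarrow> linear T \<and> (\<forall>f. 0 \<le> f \<longrightarrow> 0 \<le> T f)"

definition strictly_positive ::
    "('a::dedekind_complete_riesz_space \<Rightarrow> 'a) \<Rightarrow> bool" where
  "strictly_positive T \<longleftrightarrow>
     positive_operator T \<and> (\<forall>f. 0 \<le> f \<longrightarrow> (T f = 0 \<longleftrightarrow> f = 0))"

definition riesz_homomorphism ::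
    "('a::dedekind_complete_riesz_space \<Rightarrow> 'a) \<Rightarrow> bool" where
  "riesz_homomorphism S \<longleftrightarrow>
     linear S \<and> (\<forall>f g. S (sup f g) = sup (S f) (S g) \<and> S (inf f g) = inf (S f) (S g))"

definition conditional_expectation ::
    "('a::dedekind_complete_riesz_space \<Rightarrow> 'a) \<Rightarrow> bool" where
  "conditional_expectation T \<longleftrightarrow>
     positive_operator T \<and> order_continuous T \<and> (\<forall>f. T (T f) = T f) \<and>
     riesz_subspace (range T) \<and> dedekind_complete_set (range T) \<and>
     (\<forall>u. weak_order_unit u \<longrightarrow> weak_order_unit (T u))"

definition ce_preserving_system ::
    "('a::dedekind_complete_riesz_space \<Rightarrow> 'a) \<Rightarrow> ('a \<Rightarrow> 'a) \<Rightarrow> 'a \<Rightarrow> bool" where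
  "ce_preserving_system T S e \<longleftrightarrow>
     weak_order_unit e \<and>
     conditional_expectation T \<and> T e = e \<and>
     riesz_homomorphism S \<and> order_continuous S \<and> S e = e \<and>
     (\<forall>P. band_projection P \<longrightarrow> T (S (P e)) = T (P e))"

section \<open>Ergodicity\<close>

text \<open>Cesaro means are meant for \<open>n \<ge> 1\<close>. The value for \<open>n = 0\<close> is \<open>0\<close>; a single term does
  not affect order convergence.\<close>

definition cesaro_mean ::
    "('a::dedekind_complete_riesz_space \<Rightarrow> 'a) \<Rightarrow> nat \<Rightarrow> 'a \<Rightarrow> 'a" where
  "cesaro_mean S n f = (1 / real n) *\<^sub>R (\<Sum>k<n. (S ^^ k) f)"

definition ergodic_limit ::
    "('a::dedekind_complete_riesz_space \<Rightarrow> 'a) \<Rightarrow> 'a \<Rightarrow> 'a" where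
  "ergodic_limit S f = (THE g. order_tendsto (\<lambda>n. cesaro_mean S n f) g)"

definition invariant_set ::
    "('a::dedekind_complete_riesz_space \<Rightarrow> 'a) \<Rightarrow> 'a set" where
  "invariant_set S = {f. S f = f}"

definition ergodic ::
    "('a::dedekind_complete_riesz_space \<Rightarrow> 'a) \<Rightarrow> ('a \<Rightarrow> 'a) \<Rightarrow> bool" where
  "ergodic T S \<longleftrightarrow> (\<forall>f\<in>invariant_set S. ergodic_limit S f \<in> range T)"

section \<open>Multiplication on the ideal generated by the unit\<close>

definition bounded_elements :: "'a::dedekind_complete_riesz_space \<Rightarrow> 'a set" where
  "bounded_elements e = {f. \<exists>k\<ge>0. \<bar>f\<bar> \<le> k *\<^sub>R e}"

text \<open>The multiplication on \<open>bounded_elements e\<close> with \<open>Pe \<cdot> Qe = PQe\<close>, extended by linearity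
  and order limits. By Freudenthal's spectral theorem every bounded element is an order limit
  of a sequence of linear combinations of elements \<open>Pe\<close>, so these conditions determine \<open>m\<close>
  on \<open>bounded_elements e\<close>. The value \<open>0\<close> elsewhere is a convention that makes \<open>m\<close> unique as
  a total function.\<close>

definition is_unit_mult ::
    "'a::dedekind_complete_riesz_space \<Rightarrow> ('a \<Rightarrow> 'a \<Rightarrow> 'a) \<Rightarrow> bool" where
  "is_unit_mult e m \<longleftrightarrow>
     (let E = bounded_elements e in
       (\<forall>f\<in>E. \<forall>g\<in>E. m f g \<in> E) \<and>
       (\<forall>f\<in>E. \<forall>g\<in>E. \<forall>h\<in>E. m (f + g) h = m f h + m g h \<and> m h (f + g) = m h f + m h g) \<and>
       (\<forall>c. \<forall>f\<in>E. \<forall>g\<in>E. m (c *\<^sub>R f) g = c *\<^sub>R m f g \<and> m f (c *\<^sub>R g) = c *\<^sub>R m f g) \<and>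
       (\<forall>X x. range X \<subseteq> E \<and> x \<in> E \<and> order_tendsto X x \<longrightarrow>
          (\<forall>g\<in>E. order_tendsto (\<lambda>n. m (X n) g) (m x g) \<and>
                 order_tendsto (\<lambda>n. m g (X n)) (m g x))) \<and>
       (\<forall>P Q. band_projection P \<and> band_projection Q \<longrightarrow> m (P e) (Q e) = P (Q e)) \<and>
       (\<forall>f g. f \<notin> E \<or> g \<notin> E \<longrightarrow> m f g = 0))"

definition unit_mult :: "'a::dedekind_complete_riesz_space \<Rightarrow> 'a \<Rightarrow> 'a \<Rightarrow> 'a" where
  "unit_mult e = (THE m. is_unit_mult e m)"

section \<open>Weak mixing\<close>

definition weakly_mixing ::
    "('a::dedekind_complete_riesz_space \<Rightarrow> 'a) \<Rightarrow> ('a \<Rightarrow> 'a) \<Rightarrow> 'a \<Rightarrow> bool" where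
  "weakly_mixing T S e \<longleftrightarrow>
     (\<forall>P Q. band_projection P \<and> band_projection Q \<longrightarrow>
        order_tendsto
          (\<lambda>n. (1 / real n) *\<^sub>R
             (\<Sum>k<n. \<bar>T (unit_mult e ((S ^^ k) (P e)) (Q e)) -
                      unit_mult e (T (P e)) (T (Q e))\<bar>)) 0)"

end

theory Submission
  imports Defs
begin

text \<open>Let \<open>p\<close> be a component of \<open>e\<close>, that is \<open>p \<and> (e - p) = 0\<close>, with \<open>S p = p\<close>. Then \<open>p\<close> and
\<open>e - p\<close> are images of \<open>e\<close> under band projections, and since their product is zero, weak mixing
for this pair is a statement about a constant sequence: \<open>T p \<cdot> (e - T p) = 0\<close>. In an \<open>f\<close>-algebra
with unit \<open>e\<close> this means that \<open>g = T p\<close> is itself a component. Now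
\<open>T (p \<and> (e - g)) \<le> g \<and> (e - g) = 0\<close>, so strict positivity gives \<open>p \<le> g = T p\<close>. An element \<open>f\<close>
with \<open>f \<le> T f\<close> is fixed by \<open>T\<close>, because \<open>T (T f - f) = 0\<close> (\<open>strictly_positive_fixed\<close>). Hence
\<open>T p = p\<close> (\<open>weakly_mixing_fixes_invariant_component\<close>).

If \<open>f\<close> is invariant, so are the components generated by the elements \<open>(f - t e)\<^sup>+\<close>: the
homomorphism \<open>S\<close> can only enlarge them, \<open>T\<close> does not see the difference, and strict positivity
excludes it (\<open>invariant_principal_projection\<close>). By Freudenthal's spectral theorem an \<open>f\<close> with
\<open>0 \<le> f \<le> e\<close> is a uniform limit of combinations of such components, and a general \<open>f \<ge> 0\<close> is
the supremum of the truncations \<open>f \<and> n e\<close> because \<open>e\<close> is a weak order unit. In both cases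
\<open>f \<le> T f\<close>, so \<open>T f = f\<close>; an arbitrary invariant element is the difference of its invariant
positive and negative parts. Finally the Cesaro means of an invariant \<open>f\<close> are all equal to \<open>f\<close>,
so \<open>L\<^sub>S f = f = T f\<close> is in the range of \<open>T\<close>.

The multiplication is given only by a description, so its existence and uniqueness have to be
established before weak mixing says anything. Uniqueness is Freudenthal's theorem
once more. For existence, squares are defined by their tangents,
\<open>f\<^sup>2 = sup\<^sub>a (2 a f - a\<^sup>2 e)\<close>. The substitution \<open>(a, b) \<mapsto> ((a + b)/2, (a - b)/2)\<close> turns the
tangents of \<open>(x + y)\<^sup>2 + (x - y)\<^sup>2\<close> into those of \<open>2 x\<^sup>2 + 2 y\<^sup>2\<close>, which proves the parallelogram
law. The polarised form \<open>f \<cdot> g = ((f + g)\<^sup>2 - (f - g)\<^sup>2) / 4\<close> is then bilinear as in the theorem of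
Jordan and von Neumann, and it is positive, since squaring is monotone in the absolute value. The
estimate \<open>\<bar>f \<cdot> g\<bar> \<le> l \<bar>f\<bar>\<close> for \<open>\<bar>g\<bar> \<le> l e\<close> makes it order continuous.\<close>

section \<open>Arithmetic in Riesz spaces\<close>

text \<open>Dedekind completeness forces the Archimedean property: the supremum \<open>s\<close> of all multiples \<open>n x\<close>
would satisfy \<open>s \<le> s - x\<close>.\<close>

lemma archimedean_scaleR:
  fixes x y :: "'a::dedekind_complete_riesz_space"
  assumes "\<And>n::nat. real n *\<^sub>R x \<le> y"
  shows "x \<le> 0"
proof -
  let ?s = "SUP n::nat. real n *\<^sub>R x"
  have bdd: "bdd_above (range (\<lambda>n::nat. real n *\<^sub>R x))"
    using assms by (auto simp: bdd_above_def)
  have "real n *\<^sub>R x \<le> ?s - x" for n :: nat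
  proof -
    have "real (Suc n) *\<^sub>R x \<le> ?s"
      by (rule cSUP_upper[OF _ bdd]) simp
    thus ?thesis by (simp add: algebra_simps scaleR_add_left)
  qed
  hence "?s \<le> ?s - x" by (intro cSUP_least) auto
  thus ?thesis by simp
qed

lemma archimedean_inverse:
  fixes x y :: "'a::dedekind_complete_riesz_space"
  assumes "\<And>n::nat. x \<le> (1 / real (Suc n)) *\<^sub>R y"
  shows "x \<le> 0"
proof (rule archimedean_scaleR)
  fix n :: nat
  show "real n *\<^sub>R x \<le> sup y 0"
  proof (cases n)
    case (Suc k)
    have "real n *\<^sub>R x \<le> real n *\<^sub>R ((1 / real (Suc k)) *\<^sub>R y)"
      by (intro scaleR_left_mono assms) simp
    also have "\<dots> = y" using Suc by (simp del: of_nat_Suc)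
    finally show ?thesis by (simp add: le_supI1)
  qed simp
qed

lemma scaleR_inf_pos:
  fixes x y :: "'a::dedekind_complete_riesz_space"
  assumes "0 < c"
  shows "c *\<^sub>R inf x y = inf (c *\<^sub>R x) (c *\<^sub>R y)"
proof (rule antisym)
  show "c *\<^sub>R inf x y \<le> inf (c *\<^sub>R x) (c *\<^sub>R y)"
    using assms by (auto intro: scaleR_left_mono)
  have eq: "inf (c *\<^sub>R x) (c *\<^sub>R y) = c *\<^sub>R (inverse c *\<^sub>R inf (c *\<^sub>R x) (c *\<^sub>R y))"
    using assms by simp
  have "inverse c *\<^sub>R inf (c *\<^sub>R x) (c *\<^sub>R y) \<le> inf x y"
  proof (rule inf_greatest)
    show "inverse c *\<^sub>R inf (c *\<^sub>R x) (c *\<^sub>R y) \<le> x"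
      using assms scaleR_left_mono[of "inf (c *\<^sub>R x) (c *\<^sub>R y)" "c *\<^sub>R x" "inverse c"] by simp
    show "inverse c *\<^sub>R inf (c *\<^sub>R x) (c *\<^sub>R y) \<le> y"
      using assms scaleR_left_mono[of "inf (c *\<^sub>R x) (c *\<^sub>R y)" "c *\<^sub>R y" "inverse c"] by simp
  qed
  thus "inf (c *\<^sub>R x) (c *\<^sub>R y) \<le> c *\<^sub>R inf x y"
    using assms by (subst eq) (simp only: scaleR_left_mono less_imp_le)
qed

lemma abs_scaleR_nonneg:
  fixes x :: "'a::dedekind_complete_riesz_space"
  assumes "0 \<le> c"
  shows "\<bar>c *\<^sub>R x\<bar> = c *\<^sub>R \<bar>x\<bar>"
proof (cases "c = 0")
  case False
  have scale: "c *\<^sub>R inf x (-x) = inf (c *\<^sub>R x) (- (c *\<^sub>R x))"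
    using assms False by (simp add: scaleR_inf_pos)
  have abs: "\<bar>y\<bar> = - inf y (-y)" for y :: 'a
    unfolding neg_inf_eq_sup by (simp add: abs_lattice sup.commute)
  show ?thesis by (simp only: abs scale[symmetric] scaleR_minus_right)
qed simp

lemma abs_scaleR:
  fixes x :: "'a::dedekind_complete_riesz_space"
  shows "\<bar>c *\<^sub>R x\<bar> = \<bar>c\<bar> *\<^sub>R \<bar>x\<bar>"
  using abs_scaleR_nonneg[of c x] abs_scaleR_nonneg[of "-c" x]
  by (cases "0 \<le> c") auto

text \<open>The lattice form of \<open>min x (y + z) \<le> min x y + min x z\<close>; all statements on disjoint sums rest on it.\<close>

lemma inf_add_le_add_inf:
  fixes x y z :: "'a::dedekind_complete_riesz_space"
  assumes "0 \<le> x" "0 \<le> y" "0 \<le> z"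
  shows "inf x (y + z) \<le> inf x y + inf x z"
proof -
  have "inf x y + inf x z = inf (inf (x + x) (y + x)) (inf (x + z) (y + z))"
    by (simp only: add_inf_distrib_left add_inf_distrib_right)
  moreover have "inf x (y + z) \<le> x + x"
    using assms by (intro le_infI1) (simp add: add_increasing)
  moreover have "inf x (y + z) \<le> y + x"
    using assms by (intro le_infI1) (simp add: add_increasing)
  moreover have "inf x (y + z) \<le> x + z"
    using assms by (intro le_infI1) (simp add: add_increasing2)
  ultimately show ?thesis by simp
qed

lemma disjoint_add:
  fixes x y z :: "'a::dedekind_complete_riesz_space"
  assumes "0 \<le> x" "0 \<le> y" "0 \<le> z" "inf x y = 0" "inf x z = 0"
  shows "inf x (y + z) = 0"
  using inf_add_le_add_inf[of x y z] assms by (intro antisym) auto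

lemma disjoint_mono:
  fixes x y x' y' :: "'a::dedekind_complete_riesz_space"
  assumes "inf x y = 0" "0 \<le> x'" "x' \<le> x" "0 \<le> y'" "y' \<le> y"
  shows "inf x' y' = 0"
proof (rule antisym)
  have "inf x' y' \<le> inf x y" by (intro inf_mono assms)
  thus "inf x' y' \<le> 0" unfolding assms(1) .
qed (use assms in simp)

lemma disjoint_scaleR_nat:
  fixes x y :: "'a::dedekind_complete_riesz_space"
  assumes "0 \<le> x" "0 \<le> y" "inf y x = 0"
  shows "inf y (real n *\<^sub>R x) = 0"
proof (induction n)
  case (Suc n)
  have "inf y (x + real n *\<^sub>R x) = 0"
    using assms Suc by (intro disjoint_add) (auto simp: scaleR_nonneg_nonneg)
  thus ?case by (simp add: scaleR_add_left)
qed (use assms in \<open>auto simp: inf_absorb2\<close>)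

lemma disjoint_scaleR:
  fixes x y :: "'a::dedekind_complete_riesz_space"
  assumes "0 \<le> x" "0 \<le> y" "inf y x = 0" "0 \<le> c"
  shows "inf y (c *\<^sub>R x) = 0"
proof -
  obtain n :: nat where n: "c \<le> real n" using real_arch_simple by blast
  show ?thesis
  proof (rule disjoint_mono)
    show "inf y (real n *\<^sub>R x) = 0" by (rule disjoint_scaleR_nat[OF assms(1-3)])
    show "c *\<^sub>R x \<le> real n *\<^sub>R x" by (rule scaleR_right_mono[OF n assms(1)])
    show "0 \<le> c *\<^sub>R x" by (rule scaleR_nonneg_nonneg[OF assms(4,1)])
  qed (rule assms order_refl)+
qed

lemma disjoint_sup_eq_add:
  fixes x y :: "'a::dedekind_complete_riesz_space"
  assumes "inf x y = 0"
  shows "sup x y = x + y"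
  using add_eq_inf_sup[of x y] assms by simp

lemma pprt_le_abs: "pprt x \<le> \<bar>x::'a::dedekind_complete_riesz_space\<bar>"
  by (simp add: pprt_def abs_ge_self)

lemma neg_nprt_le_abs: "- nprt x \<le> \<bar>x::'a::dedekind_complete_riesz_space\<bar>"
  using pprt_le_abs[of "-x"] by (simp add: pprt_neg)

lemma pprt_disjoint:
  fixes x :: "'a::dedekind_complete_riesz_space"
  shows "inf (pprt x) (pprt (-x)) = 0"
proof -
  have "pprt x = x + pprt (-x)"
    using prts[of x] pprt_neg[of x] by (simp add: algebra_simps)
  moreover have "inf (x + pprt (-x)) (0 + pprt (-x)) = inf x 0 + pprt (-x)"
    by (simp add: add_inf_distrib_right)
  moreover have "inf x 0 = - pprt (-x)"
    by (simp add: pprt_neg nprt_def)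
  ultimately show ?thesis by simp
qed

section \<open>Order limits\<close>

text \<open>Since \<^const>\<open>Inf\<close> is conditional, it is convenient to express \<open>v \<down> 0\<close> by saying that
every lower bound of \<open>v\<close> is at most \<open>0\<close>.\<close>

lemma order_tendstoI:
  fixes X v :: "nat \<Rightarrow> 'a::dedekind_complete_riesz_space"
  assumes "decseq v" "\<And>n. \<bar>X n - x\<bar> \<le> v n" "\<And>z. (\<And>n. z \<le> v n) \<Longrightarrow> z \<le> 0"
  shows "order_tendsto X x"
proof -
  have nn: "0 \<le> v n" for n
    using order_trans[OF abs_ge_zero assms(2)] .
  have bdd: "bdd_below (range v)" using nn by (auto simp: bdd_below_def)
  have "(INF n. v n) \<le> 0"
    by (rule assms(3)) (rule cINF_lower[OF bdd], simp)
  moreover have "0 \<le> (INF n. v n)" by (rule cINF_greatest) (auto simp: nn)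
  ultimately show ?thesis
    unfolding order_tendsto_def using assms by (intro exI[of _ v]) auto
qed

lemma order_tendstoE:
  fixes X :: "nat \<Rightarrow> 'a::dedekind_complete_riesz_space"
  assumes "order_tendsto X x"
  obtains v where "decseq v" "\<forall>n. \<bar>X n - x\<bar> \<le> v n" "\<forall>z. (\<forall>n. z \<le> v n) \<longrightarrow> z \<le> 0"
proof -
  obtain v where v: "decseq v" "\<forall>n. \<bar>X n - x\<bar> \<le> v n" "(INF n. v n) = 0"
    using assms unfolding order_tendsto_def by blast
  have "z \<le> 0" if "\<forall>n. z \<le> v n" for z
  proof -
    have "z \<le> (INF n. v n)" using that by (intro cINF_greatest) auto
    thus ?thesis using v by simp
  qed
  thus thesis using that[OF v(1,2)] by blast
qed

lemma order_tendsto_unique: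
  fixes X :: "nat \<Rightarrow> 'a::dedekind_complete_riesz_space"
  assumes "order_tendsto X x" "order_tendsto X y"
  shows "x = y"
proof -
  obtain v where v: "decseq v" "\<forall>n. \<bar>X n - x\<bar> \<le> v n" "\<forall>z. (\<forall>n. z \<le> v n) \<longrightarrow> z \<le> 0"
    using order_tendstoE[OF assms(1)] by blast
  obtain w where w: "decseq w" "\<forall>n. \<bar>X n - y\<bar> \<le> w n" "\<forall>z. (\<forall>n. z \<le> w n) \<longrightarrow> z \<le> 0"
    using order_tendstoE[OF assms(2)] by blast
  have "\<bar>x - y\<bar> \<le> v n + w m" for n m
  proof -
    let ?k = "max n m"
    have "\<bar>x - y\<bar> \<le> \<bar>X ?k - x\<bar> + \<bar>X ?k - y\<bar>"
      using abs_triangle_ineq4[of "X ?k - y" "X ?k - x"] by (simp add: algebra_simps)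
    also have "\<dots> \<le> v ?k + w ?k" using v(2) w(2) by (intro add_mono) blast+
    also have "\<dots> \<le> v n + w m"
      using v(1) w(1) by (intro add_mono) (auto simp: decseq_def)
    finally show ?thesis .
  qed
  hence "\<bar>x - y\<bar> - v n \<le> 0" for n
    by (intro w(3)[rule_format]) (simp add: algebra_simps)
  hence "\<bar>x - y\<bar> \<le> 0" by (intro v(3)[rule_format]) simp
  thus ?thesis by simp
qed

text \<open>Averages over \<open>n\<close> terms have the junk value \<open>0\<close> at \<open>n = 0\<close>, so the sequences that occur are
constant only from \<open>n = 1\<close> on.\<close>

lemma order_tendsto_eventually_const:
  fixes X :: "nat \<Rightarrow> 'a::dedekind_complete_riesz_space"
  assumes "\<And>n. 0 < n \<Longrightarrow> X n = x"
  shows "order_tendsto X x"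
proof (rule order_tendstoI)
  show "decseq (\<lambda>n. if n = 0 then \<bar>X 0 - x\<bar> else 0)" by (auto simp: decseq_def)
  show "\<bar>X n - x\<bar> \<le> (if n = 0 then \<bar>X 0 - x\<bar> else 0)" for n using assms by auto
  show "z \<le> 0" if "\<And>n. z \<le> (if n = (0::nat) then \<bar>X 0 - x\<bar> else 0)" for z
    using that[of 1] by simp
qed

section \<open>Disjoint complements and band projections\<close>

lemma disjoint_complementI:
  "(\<And>g. g \<in> A \<Longrightarrow> inf \<bar>f\<bar> \<bar>g\<bar> = 0) \<Longrightarrow> f \<in> disjoint_complement A"
  by (simp add: disjoint_complement_def)

lemma disjoint_complementD:
  "f \<in> disjoint_complement A \<Longrightarrow> g \<in> A \<Longrightarrow> inf \<bar>f\<bar> \<bar>g\<bar> = 0"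
  by (simp add: disjoint_complement_def)

lemma subset_double_complement: "A \<subseteq> disjoint_complement (disjoint_complement A)"
proof (intro subsetI disjoint_complementI)
  fix f g assume "f \<in> A" "g \<in> disjoint_complement A"
  hence "inf \<bar>g\<bar> \<bar>f\<bar> = 0" by (intro disjoint_complementD)
  thus "inf \<bar>f\<bar> \<bar>g\<bar> = 0" by (simp only: inf.commute)
qed

lemma riesz_ideal_disjoint_complement: "riesz_ideal (disjoint_complement A)"
  unfolding riesz_ideal_def
proof (intro conjI allI impI subspaceI)
  show "0 \<in> disjoint_complement A" by (auto simp: disjoint_complement_def inf_absorb1)
  have solid: "f \<in> disjoint_complement A"
    if "g \<in> disjoint_complement A" "\<bar>f\<bar> \<le> \<bar>g\<bar>" for f g
  proof (rule disjoint_complementI)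
    fix h assume "h \<in> A"
    thus "inf \<bar>f\<bar> \<bar>h\<bar> = 0"
      using that by (intro disjoint_mono[OF disjoint_complementD[OF that(1)]]) auto
  qed
  thus "f \<in> disjoint_complement A" if "g \<in> disjoint_complement A \<and> \<bar>f\<bar> \<le> \<bar>g\<bar>" for f g
    using that by blast
  show "x + y \<in> disjoint_complement A"
    if "x \<in> disjoint_complement A" "y \<in> disjoint_complement A" for x y
  proof (rule disjoint_complementI)
    fix h assume "h \<in> A"
    hence "inf \<bar>h\<bar> \<bar>x\<bar> = 0" "inf \<bar>h\<bar> \<bar>y\<bar> = 0"
      using that[THEN disjoint_complementD] by (simp_all only: inf.commute)
    hence "inf \<bar>h\<bar> (\<bar>x\<bar> + \<bar>y\<bar>) = 0" by (intro disjoint_add abs_ge_zero)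
    hence "inf (\<bar>x\<bar> + \<bar>y\<bar>) \<bar>h\<bar> = 0" by (simp add: inf.commute)
    thus "inf \<bar>x + y\<bar> \<bar>h\<bar> = 0"
      by (rule disjoint_mono) (auto intro: abs_triangle_ineq)
  qed
  show "c *\<^sub>R x \<in> disjoint_complement A" if "x \<in> disjoint_complement A" for c x
  proof (rule disjoint_complementI)
    fix h assume "h \<in> A"
    hence "inf \<bar>h\<bar> \<bar>x\<bar> = 0"
      using that[THEN disjoint_complementD] by (simp only: inf.commute)
    hence "inf \<bar>h\<bar> (\<bar>c\<bar> *\<^sub>R \<bar>x\<bar>) = 0" by (intro disjoint_scaleR abs_ge_zero)
    thus "inf \<bar>c *\<^sub>R x\<bar> \<bar>h\<bar> = 0" by (simp add: abs_scaleR inf.commute)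
  qed
qed

text \<open>Closure under suprema: if all \<open>d\<^sup>+\<close> are disjoint from \<open>\<bar>g\<bar>\<close>, then with \<open>h = x\<^sup>+ \<and> \<bar>g\<bar>\<close>, where
\<open>x\<close> is the supremum, \<open>d\<^sup>+ + h = d\<^sup>+ \<or> h \<le> x\<^sup>+\<close>. So \<open>x\<^sup>+ - h\<close> is an upper bound as well, which
forces \<open>h = 0\<close>. The negative part of \<open>x\<close> is dominated by that of any single \<open>d\<close>.\<close>

lemma riesz_band_disjoint_complement: "riesz_band (disjoint_complement A)"
  unfolding riesz_band_def
proof (intro conjI allI impI riesz_ideal_disjoint_complement)
  fix D :: "'a set" assume D: "D \<subseteq> disjoint_complement A \<and> D \<noteq> {} \<and> bdd_above D"
  let ?x = "Sup D"
  obtain d0 where d0: "d0 \<in> D" using D by blast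
  have le: "d \<le> ?x" if "d \<in> D" for d using that D by (auto intro: cSup_upper)
  show "?x \<in> disjoint_complement A"
  proof (rule disjoint_complementI)
    fix g assume g: "g \<in> A"
    have disj: "inf \<bar>d\<bar> \<bar>g\<bar> = 0" if "d \<in> D" for d
      using that g D by (auto dest: disjoint_complementD)
    have posd: "inf (pprt d) \<bar>g\<bar> = 0" if "d \<in> D" for d
      using disj[OF that] by (rule disjoint_mono) (simp_all add: pprt_le_abs neg_nprt_le_abs)
    define h where "h = inf (pprt ?x) \<bar>g\<bar>"
    have h0: "0 \<le> h" by (simp add: h_def)
    have "pprt d \<le> pprt ?x - h" if "d \<in> D" for d
    proof -
      have "inf (pprt d) h = 0"
        by (rule disjoint_mono[OF posd[OF that]]) (auto simp: h_def)
      hence "pprt d + h = sup (pprt d) h" by (simp add: disjoint_sup_eq_add)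
      also have "\<dots> \<le> pprt ?x" using le[OF that] by (auto simp: h_def pprt_mono)
      finally show ?thesis by (simp add: algebra_simps)
    qed
    hence "d \<le> pprt ?x - h" if "d \<in> D" for d
      using that order_trans[of d "pprt d"] by (auto simp: pprt_def)
    hence "?x \<le> pprt ?x - h" using D by (intro cSup_least) auto
    moreover have "0 \<le> pprt ?x - h"
      unfolding diff_ge_0_iff_ge h_def by (rule inf_le1)
    ultimately have "pprt ?x \<le> pprt ?x - h" by (simp add: pprt_def[of ?x])
    hence hz: "h = 0" using h0 by simp
    have "- nprt ?x \<le> - nprt d0" using le[OF d0] by (simp add: nprt_mono)
    also have "\<dots> \<le> \<bar>d0\<bar>" by (rule neg_nprt_le_abs)
    finally have "inf (- nprt ?x) \<bar>g\<bar> = 0"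
      by (intro disjoint_mono[OF disj[OF d0]]) auto
    hence "inf \<bar>g\<bar> (pprt ?x + - nprt ?x) = 0"
      using hz by (intro disjoint_add) (auto simp: h_def inf.commute)
    thus "inf \<bar>?x\<bar> \<bar>g\<bar> = 0" by (simp add: abs_prts inf.commute)
  qed
qed

text \<open>Positivity can be read off the two parts of the decomposition along a band. This one fact replaces
linearity and positivity of band projections below.\<close>

lemma band_sum_nonneg:
  fixes a b :: "'a::dedekind_complete_riesz_space"
  assumes "a \<in> B" "b \<in> disjoint_complement B" "0 \<le> a + b"
  shows "0 \<le> a" "0 \<le> b"
proof -
  have disj: "inf \<bar>a\<bar> \<bar>b\<bar> = 0"
    using assms by (metis disjoint_complementD inf.commute)
  have neg: "0 \<le> x" if "inf \<bar>x\<bar> \<bar>y\<bar> = 0" "0 \<le> x + y" for x y :: 'a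
  proof -
    have "x + y = (pprt x + nprt x) + (pprt y + nprt y)" by (simp flip: prts)
    hence "0 \<le> nprt x + (pprt x + (pprt y + nprt y))" using that(2) by (simp add: ac_simps)
    hence "- nprt x \<le> pprt x + (pprt y + nprt y)"
      using add_left_mono[of 0 "nprt x + (pprt x + (pprt y + nprt y))" "- nprt x"] by simp
    also have "\<dots> \<le> pprt x + \<bar>y\<bar>" by (simp flip: prts add: abs_ge_self)
    finally have 1: "- nprt x = inf (- nprt x) (pprt x + \<bar>y\<bar>)" by (simp add: inf_absorb1)
    have "inf (- nprt x) (pprt x) = 0"
      using pprt_disjoint[of x] by (simp add: pprt_neg inf.commute)
    moreover have "inf (- nprt x) \<bar>y\<bar> = 0"
      using that(1) by (rule disjoint_mono) (simp_all add: pprt_le_abs neg_nprt_le_abs)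
    ultimately have "inf (- nprt x) (pprt x + \<bar>y\<bar>) = 0" by (intro disjoint_add) auto
    hence "nprt x = 0" using 1 by simp
    thus ?thesis by (metis nprt_def inf_le1)
  qed
  show "0 \<le> a" using neg[OF disj] assms by simp
  show "0 \<le> b" using neg[of b a] disj assms by (simp add: inf.commute add.commute)
qed

text \<open>For \<open>u, f \<ge> 0\<close> this is the usual formula for the projection of \<open>f\<close> onto the band generated by
\<open>u\<close>. The case \<open>f = e\<close> gives the components of the unit, the case \<open>u = e\<close> the truncations of \<open>f\<close>.\<close>

definition principal_projection ::
    "'a::dedekind_complete_riesz_space \<Rightarrow> 'a \<Rightarrow> 'a" where
  "principal_projection u f = (SUP n::nat. inf (real n *\<^sub>R u) f)"

lemma principal_projection_upper:
  "inf (real n *\<^sub>R u) f \<le> principal_projection u f"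
  unfolding principal_projection_def
  by (rule cSUP_upper) (auto simp: bdd_above_def intro!: exI[of _ f])

lemma principal_projection_least:
  "(\<And>n::nat. inf (real n *\<^sub>R u) f \<le> z) \<Longrightarrow> principal_projection u f \<le> z"
  unfolding principal_projection_def by (rule cSUP_least) auto

lemma principal_projection_le: "principal_projection u f \<le> f"
  by (rule principal_projection_least) simp

lemma principal_projection_nonneg:
  "0 \<le> f \<Longrightarrow> 0 \<le> principal_projection u f"
  using principal_projection_upper[of 0 u f] by (simp add: inf_absorb1)

text \<open>A common part \<open>h\<close> of the remainder and of \<open>u\<close> could be added to every \<open>n u \<and> f\<close> and would still
give an element below \<open>(n + 1) u \<and> f\<close>. The supremum leaves no room for that.\<close>

lemma principal_projection_rest_disjoint:
  assumes "0 \<le> u" "0 \<le> f"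
  shows "inf (f - principal_projection u f) u = 0"
proof (rule antisym)
  let ?p = "principal_projection u f"
  define h where "h = inf (f - ?p) u"
  have "inf (real n *\<^sub>R u) f \<le> ?p - h" for n
  proof -
    have "inf (real n *\<^sub>R u) f + h \<le> real n *\<^sub>R u + u"
      by (intro add_mono) (auto simp: h_def)
    moreover have "inf (real n *\<^sub>R u) f + h \<le> ?p + (f - ?p)"
      by (intro add_mono principal_projection_upper) (simp add: h_def)
    ultimately have "inf (real n *\<^sub>R u) f + h \<le> inf (real (Suc n) *\<^sub>R u) f"
      by (simp add: scaleR_add_left add.commute)
    also have "\<dots> \<le> ?p" by (rule principal_projection_upper)
    finally show ?thesis by (simp add: algebra_simps)
  qed
  hence "?p \<le> ?p - h" by (rule principal_projection_least)
  hence "h \<le> 0" by simp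
  thus "inf (f - ?p) u \<le> 0" unfolding h_def .
  show "0 \<le> inf (f - ?p) u" using assms principal_projection_le[of u f] by simp
qed

lemma principal_projection_in_band:
  assumes "0 \<le> u" "0 \<le> f"
  shows "principal_projection u f \<in> disjoint_complement (disjoint_complement {u})"
proof -
  let ?B = "disjoint_complement (disjoint_complement {u})"
  have B: "riesz_ideal ?B" "riesz_band ?B"
    by (rule riesz_ideal_disjoint_complement riesz_band_disjoint_complement)+
  have u: "u \<in> ?B" using subset_double_complement[of "{u}"] by blast
  have "inf (real n *\<^sub>R u) f \<in> ?B" for n
  proof -
    have "real n *\<^sub>R u \<in> ?B" using B(1) u by (auto simp: riesz_ideal_def subspace_def)
    moreover have "\<bar>inf (real n *\<^sub>R u) f\<bar> \<le> \<bar>real n *\<^sub>R u\<bar>"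
      using assms by (simp add: abs_of_nonneg scaleR_nonneg_nonneg)
    ultimately show ?thesis using B(1) unfolding riesz_ideal_def by blast
  qed
  hence "range (\<lambda>n::nat. inf (real n *\<^sub>R u) f) \<subseteq> ?B" by blast
  moreover have "bdd_above (range (\<lambda>n::nat. inf (real n *\<^sub>R u) f))"
    by (auto simp: bdd_above_def intro!: exI[of _ f])
  ultimately show ?thesis
    using B(2) unfolding riesz_band_def principal_projection_def by blast
qed

lemma principal_band_projection_exists:
  fixes u :: "'a::dedekind_complete_riesz_space"
  assumes "0 \<le> u"
  shows "\<exists>P. band_projection P \<and> (\<forall>f\<ge>0. P f = principal_projection u f)"
proof -
  let ?B = "disjoint_complement (disjoint_complement {u})"
  let ?P = "\<lambda>f. principal_projection u (pprt f) - principal_projection u (pprt (-f))"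
  have ideal: "riesz_ideal ?B" "riesz_ideal (disjoint_complement ?B)"
    by (rule riesz_ideal_disjoint_complement)+
  have rest: "f - principal_projection u f \<in> disjoint_complement ?B" if "0 \<le> f" for f
  proof -
    have "f - principal_projection u f \<in> disjoint_complement {u}"
      using principal_projection_rest_disjoint[OF assms that] principal_projection_le[of u f] assms
      by (simp add: disjoint_complement_def)
    thus ?thesis using subset_double_complement[of "disjoint_complement {u}"] by blast
  qed
  have "?P f \<in> ?B \<and> f - ?P f \<in> disjoint_complement ?B" for f
  proof
    show "?P f \<in> ?B"
      using ideal(1) assms
      by (intro subspace_diff principal_projection_in_band) (auto simp: riesz_ideal_def)
    have "f = pprt f - pprt (-f)" using prts[of f] by (simp add: pprt_neg)
    hence "f - ?P f = (pprt f - principal_projection u (pprt f))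
        - (pprt (-f) - principal_projection u (pprt (-f)))"
      by (simp add: algebra_simps)
    also have "\<dots> \<in> disjoint_complement ?B"
      using ideal(2) by (intro subspace_diff rest) (auto simp: riesz_ideal_def)
    finally show "f - ?P f \<in> disjoint_complement ?B" .
  qed
  hence "band_projection ?P"
    unfolding band_projection_def using riesz_band_disjoint_complement by blast
  moreover have "?P f = principal_projection u f" if "0 \<le> f" for f
  proof -
    have "principal_projection u 0 = 0"
      using principal_projection_le[of u 0] principal_projection_nonneg[of 0 u] by simp
    thus ?thesis using that by (simp add: pprt_eq_id pprt_eq_0)
  qed
  ultimately show ?thesis by blast
qed

section \<open>Components of the unit\<close>

definition component :: "'a::dedekind_complete_riesz_space \<Rightarrow> 'a \<Rightarrow> bool" where
  "component e p \<longleftrightarrow> inf p (e - p) = 0"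

lemma component_nonneg: "component e p \<Longrightarrow> 0 \<le> p"
  by (metis component_def inf_le1)

lemma component_le: "component e p \<Longrightarrow> p \<le> e"
  by (metis component_def inf_le2 diff_ge_0_iff_ge)

lemma component_complement: "component e p \<Longrightarrow> component e (e - p)"
  by (simp add: component_def inf.commute)

lemma component_unit_nonneg: "component e p \<Longrightarrow> 0 \<le> e"
  using component_nonneg component_le order_trans by blast

text \<open>The complement of \<open>p \<and> q\<close> lies below \<open>(e - p) + (e - q)\<close>, and both summands are disjoint from
\<open>p \<and> q\<close>.\<close>

lemma component_inf:
  fixes e p q :: "'a::dedekind_complete_riesz_space"
  assumes p: "component e p" and q: "component e q"
  shows "component e (inf p q)"
proof -
  note b = component_nonneg[OF p] component_nonneg[OF q] component_le[OF p] component_le[OF q]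
  define r where "r = inf p q"
  have r0: "0 \<le> r" using b by (simp add: r_def)
  have rpq: "r \<le> p" "r \<le> q" by (simp_all add: r_def)
  have "inf r (e - p) = 0" "inf r (e - q) = 0"
    using r0 b rpq by (auto intro: disjoint_mono[OF p[unfolded component_def]]
        disjoint_mono[OF q[unfolded component_def]])
  hence disj: "inf r ((e - p) + (e - q)) = 0" using b r0 by (intro disjoint_add) auto
  have "p + q - e \<le> p" "p + q - e \<le> q"
    using add_left_mono[OF b(4), of p] add_right_mono[OF b(3), of q]
    by (simp_all add: diff_le_eq add.commute)
  hence "p + q - e \<le> r" unfolding r_def by (rule inf_greatest)
  hence le: "e - r \<le> (e - p) + (e - q)" by (simp add: algebra_simps)
  have "0 \<le> e - r" using order_trans[OF rpq(1) b(3)] by simp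
  hence "inf r (e - r) = 0" by (rule disjoint_mono[OF disj r0 order_refl _ le])
  thus ?thesis by (simp only: component_def r_def)
qed

lemma component_principal_projection:
  assumes "0 \<le> u" "0 \<le> e"
  shows "component e (principal_projection u e)"
proof -
  let ?p = "principal_projection u e"
  have "e - ?p \<in> disjoint_complement {u}"
    using principal_projection_rest_disjoint[OF assms] principal_projection_le[of u e] assms
    by (simp add: disjoint_complement_def)
  hence "inf \<bar>?p\<bar> \<bar>e - ?p\<bar> = 0"
    using principal_projection_in_band[OF assms] by (auto dest: disjoint_complementD)
  thus ?thesis
    using principal_projection_le[of u e] principal_projection_nonneg[OF assms(2), of u]
    by (simp add: component_def)
qed

text \<open>Together with \<open>band_projection_component\<close>: the elements \<open>P e\<close> are exactly the components of \<open>e\<close>,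
so statements about band projections become statements inside the lattice.\<close>

lemma component_band_projection:
  assumes "component e p"
  shows "\<exists>P. band_projection P \<and> P e = p"
proof -
  have p: "0 \<le> p" "p \<le> e" "0 \<le> e"
    using assms component_nonneg component_le component_unit_nonneg by blast+
  have "principal_projection p e = p"
  proof (rule antisym)
    show "principal_projection p e \<le> p"
    proof (rule principal_projection_least)
      fix n :: nat
      have "inf (real n *\<^sub>R p) (p + (e - p))
          \<le> inf (real n *\<^sub>R p) p + inf (real n *\<^sub>R p) (e - p)"
        using p by (intro inf_add_le_add_inf) (auto simp: scaleR_nonneg_nonneg)
      also have "inf (real n *\<^sub>R p) (e - p) = 0"
        using disjoint_scaleR_nat[of p "e - p" n] p assms
        by (simp add: component_def inf.commute)
      finally show "inf (real n *\<^sub>R p) e \<le> p" by (simp add: le_infI2)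
    qed
    show "p \<le> principal_projection p e"
      using principal_projection_upper[of 1 p e] p by (simp add: inf_absorb1)
  qed
  thus ?thesis using principal_band_projection_exists[OF p(1)] p by metis
qed

lemma band_projection_component:
  assumes "band_projection P" "0 \<le> e"
  shows "component e (P e)"
proof -
  obtain B where B: "riesz_band B" "\<And>f. P f \<in> B" "\<And>f. f - P f \<in> disjoint_complement B"
    using assms unfolding band_projection_def by blast
  have "0 \<le> P e" "0 \<le> e - P e"
    using band_sum_nonneg[OF B(2,3), of e e] assms by auto
  moreover have "inf \<bar>e - P e\<bar> \<bar>P e\<bar> = 0"
    using B(2,3) by (auto dest: disjoint_complementD)
  ultimately show ?thesis by (simp add: component_def inf.commute)
qed

text \<open>The prescribed product \<open>P Q e\<close> of \<open>P e\<close> and \<open>Q e\<close> is their infimum.\<close>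

lemma band_projection_comp_unit:
  fixes e :: "'a::dedekind_complete_riesz_space"
  assumes P: "band_projection P" and Q: "band_projection Q" and e: "0 \<le> e"
  shows "P (Q e) = inf (P e) (Q e)"
proof -
  obtain B where B: "riesz_band B" "\<And>f. P f \<in> B" "\<And>f. f - P f \<in> disjoint_complement B"
    using P unfolding band_projection_def by blast
  have ideal: "riesz_ideal B" "subspace B" "subspace (disjoint_complement B)"
    using B(1) riesz_ideal_disjoint_complement[of B]
    by (auto simp: riesz_band_def riesz_ideal_def)
  have pe: "0 \<le> P e" using band_projection_component[OF P e] component_nonneg by blast
  have q: "0 \<le> Q e" "Q e \<le> e"
    using band_projection_component[OF Q e] component_nonneg component_le by blast+
  have "P (Q e) \<le> Q e"
    using band_sum_nonneg[OF B(2,3), of "Q e" "Q e"] q by simp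
  moreover have "0 \<le> P e - P (Q e)"
    using band_sum_nonneg(1)[OF subspace_diff[OF ideal(2) B(2) B(2)]
        subspace_diff[OF ideal(3) B(3) B(3)], of e "Q e" e "Q e"] q
    by simp
  moreover have "inf (P e) (Q e) \<le> P (Q e)"
  proof -
    define h where "h = inf (P e) (Q e)"
    have "\<bar>h\<bar> \<le> \<bar>P e\<bar>" using pe q by (simp add: h_def abs_of_nonneg)
    hence "h \<in> B" using ideal(1) B(2) unfolding riesz_ideal_def by blast
    moreover have "h \<le> Q e" by (simp add: h_def)
    ultimately have "0 \<le> P (Q e) - h"
      using band_sum_nonneg(1)[OF subspace_diff[OF ideal(2) B(2)] B(3), of h "Q e" "Q e"] by simp
    thus ?thesis by (simp only: h_def diff_ge_0_iff_ge)
  qed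
  ultimately show ?thesis by (intro antisym) auto
qed

section \<open>Freudenthal approximation\<close>

text \<open>With \<open>r' = (r - c)\<^sup>+\<close> the layer of \<open>r\<close> of height \<open>c = e / N\<close> is \<open>r - r' = r \<and> c\<close>. After scaling
by \<open>N\<close> it is caught between the component where \<open>r > c\<close> and the component where \<open>r > 0\<close>. For the
lower bound note that \<open>e \<le> N r + N (c - r)\<^sup>+\<close> and that \<open>r'\<close> is disjoint from \<open>(c - r)\<^sup>+\<close>.\<close>

lemma freudenthal_step:
  fixes r c :: "'a::dedekind_complete_riesz_space"
  assumes r: "0 \<le> r" and c: "0 \<le> c" and N: "0 < N"
  defines "e \<equiv> real N *\<^sub>R c" and "r' \<equiv> pprt (r - c)"
  shows "principal_projection r' e \<le> real N *\<^sub>R (r - r')"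
    and "real N *\<^sub>R (r - r') \<le> principal_projection r e"
proof -
  have "r - r' = inf r c"
  proof -
    have "inf r c = r + inf 0 (c - r)" by (simp add: add_inf_distrib_left)
    also have "inf 0 (c - r) = - r'"
      unfolding r'_def pprt_def neg_sup_eq_inf by (simp add: inf.commute)
    finally show ?thesis by simp
  qed
  hence eq: "real N *\<^sub>R (r - r') = inf (real N *\<^sub>R r) e"
    using N by (simp add: scaleR_inf_pos e_def)
  show "real N *\<^sub>R (r - r') \<le> principal_projection r e"
    unfolding eq by (rule principal_projection_upper)
  show "principal_projection r' e \<le> real N *\<^sub>R (r - r')"
    unfolding eq
  proof (intro inf_greatest principal_projection_least)
    fix n :: nat
    let ?s = "pprt (c - r)"
    have disj: "inf (real n *\<^sub>R r') (real N *\<^sub>R ?s) = 0"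
    proof -
      have "inf ?s r' = 0" using pprt_disjoint[of "c - r"] by (simp add: r'_def)
      hence "inf ?s (real n *\<^sub>R r') = 0"
        by (intro disjoint_scaleR_nat) (auto simp: r'_def)
      thus ?thesis
        by (intro disjoint_scaleR_nat)
           (auto simp: r'_def inf.commute scaleR_nonneg_nonneg)
    qed
    have "inf (real n *\<^sub>R r') e
        \<le> inf (real n *\<^sub>R r') (real N *\<^sub>R r + real N *\<^sub>R ?s)"
    proof -
      have "c \<le> r + ?s" by (simp add: pprt_def add_sup_distrib_left)
      hence "e \<le> real N *\<^sub>R (r + ?s)" unfolding e_def by (rule scaleR_left_mono) simp
      thus ?thesis by (intro inf_mono) (auto simp: scaleR_add_right)
    qed
    also have "inf (real n *\<^sub>R r') (real N *\<^sub>R r + real N *\<^sub>R ?s)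
        \<le> inf (real n *\<^sub>R r') (real N *\<^sub>R r) + inf (real n *\<^sub>R r') (real N *\<^sub>R ?s)"
      using r by (intro inf_add_le_add_inf) (auto simp: r'_def scaleR_nonneg_nonneg)
    finally have "inf (real n *\<^sub>R r') e \<le> inf (real n *\<^sub>R r') (real N *\<^sub>R r)"
      unfolding disj add_0_right .
    thus "inf (real n *\<^sub>R r') e \<le> real N *\<^sub>R r" by simp
  qed (rule inf_le2)
qed

text \<open>The lower step function of \<open>f\<close> with \<open>N\<close> equidistant levels: level \<open>j / N\<close> contributes the
component where \<open>f\<close> exceeds it.\<close>

definition step_approx ::
    "'a::dedekind_complete_riesz_space \<Rightarrow> nat \<Rightarrow> 'a \<Rightarrow> 'a" where
  "step_approx e N f = (1 / real N) *\<^sub>R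
     (\<Sum>j<N. principal_projection (pprt (f - (real (Suc j) / real N) *\<^sub>R e)) e)"

text \<open>The residues \<open>r\<^sub>j = (f - (j / N) e)\<^sup>+\<close> telescope from \<open>f\<close> to \<open>0\<close>. Each layer lies between two
consecutive components, so upper and lower sums differ by at most one component divided by \<open>N\<close>.\<close>

lemma step_approx_bounds:
  assumes f: "0 \<le> f" "f \<le> e" and N: "0 < N"
  shows "step_approx e N f \<le> f" and "f \<le> step_approx e N f + (1 / real N) *\<^sub>R e"
proof -
  have e: "0 \<le> e" using f by (rule order_trans)
  define c where "c = (1 / real N) *\<^sub>R e"
  define r where "r j = pprt (f - (real j / real N) *\<^sub>R e)" for j
  define p where "p j = principal_projection (r j) e" for j
  have c: "0 \<le> c" "real N *\<^sub>R c = e"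
    using e N by (auto simp: c_def scaleR_nonneg_nonneg)
  have r0: "0 \<le> r j" for j by (simp add: r_def)
  have rSuc: "r (Suc j) = pprt (r j - c)" for j
  proof -
    define w where "w = f - (real j / real N) *\<^sub>R e"
    have "w - c = f - (real (Suc j) / real N) *\<^sub>R e"
      by (simp add: w_def c_def add_divide_distrib scaleR_add_left algebra_simps)
    hence "r (Suc j) = pprt (w - c)" by (simp only: r_def)
    moreover have "pprt (pprt w - c) = pprt (w - c)"
    proof -
      have "pprt w - c = sup (w - c) (- c)"
        by (simp add: pprt_def add_sup_distrib_right diff_conv_add_uminus del: add_uminus_conv_diff)
      hence "pprt (pprt w - c) = sup (w - c) (sup (- c) 0)" by (simp add: pprt_def sup.assoc)
      also have "sup (- c) 0 = 0" using c by (simp add: sup_absorb2)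
      finally show ?thesis by (simp add: pprt_def)
    qed
    ultimately show ?thesis by (simp add: r_def w_def)
  qed
  have lo: "p (Suc j) \<le> real N *\<^sub>R (r j - r (Suc j))"
    and hi: "real N *\<^sub>R (r j - r (Suc j)) \<le> p j" for j
    using freudenthal_step[OF r0 c(1) N, of j] c(2) by (simp_all add: p_def rSuc)
  have "(\<Sum>j<N. r j - r (Suc j)) = r 0 - r N" by (rule sum_lessThan_telescope')
  also have "\<dots> = f" using f N by (simp add: r_def pprt_eq_id pprt_eq_0)
  finally have tel: "(\<Sum>j<N. real N *\<^sub>R (r j - r (Suc j))) = real N *\<^sub>R f"
    by (simp flip: scaleR_sum_right)
  have step: "step_approx e N f = (1 / real N) *\<^sub>R (\<Sum>j<N. p (Suc j))"
    by (simp add: step_approx_def p_def r_def)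
  have fN: "(1 / real N) *\<^sub>R (real N *\<^sub>R f) = f" using N by simp
  have "(\<Sum>j<N. p (Suc j)) \<le> real N *\<^sub>R f"
    unfolding tel[symmetric] by (rule sum_mono) (rule lo)
  hence "step_approx e N f \<le> (1 / real N) *\<^sub>R (real N *\<^sub>R f)"
    unfolding step by (rule scaleR_left_mono) simp
  thus "step_approx e N f \<le> f" using fN by simp
  have "real N *\<^sub>R f \<le> (\<Sum>j<N. p j)"
    unfolding tel[symmetric] by (rule sum_mono) (rule hi)
  also have "\<dots> \<le> (\<Sum>j<N. p j) + p N"
    using e by (simp add: p_def principal_projection_nonneg)
  also have "\<dots> = p 0 + (\<Sum>j<N. p (Suc j))"
    by (metis sum.lessThan_Suc sum.lessThan_Suc_shift)
  also have "\<dots> \<le> e + (\<Sum>j<N. p (Suc j))"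
    by (simp add: p_def principal_projection_le)
  finally have "(1 / real N) *\<^sub>R (real N *\<^sub>R f) \<le> (1 / real N) *\<^sub>R (e + (\<Sum>j<N. p (Suc j)))"
    by (rule scaleR_left_mono) simp
  thus "f \<le> step_approx e N f + (1 / real N) *\<^sub>R e"
    using fN by (simp add: step scaleR_add_right add.commute)
qed

lemma step_approx_tendsto:
  fixes f :: "'a::dedekind_complete_riesz_space"
  assumes f: "0 \<le> f" "f \<le> e"
  shows "order_tendsto (\<lambda>n. step_approx e (Suc n) f) f"
proof (rule order_tendstoI)
  have e: "0 \<le> e" using f by (rule order_trans)
  show "decseq (\<lambda>n. (1 / real (Suc n)) *\<^sub>R e)"
    unfolding decseq_def using e by (intro allI impI scaleR_right_mono) (auto simp: field_simps)
  show "z \<le> 0" if "\<And>n. z \<le> (1 / real (Suc n)) *\<^sub>R e" for z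
    using that by (rule archimedean_inverse)
  fix n :: nat
  note b = step_approx_bounds[OF f, of "Suc n"]
  show "\<bar>step_approx e (Suc n) f - f\<bar> \<le> (1 / real (Suc n)) *\<^sub>R e"
  proof (rule abs_leI)
    have "step_approx e (Suc n) f - f \<le> 0" using b(1) by simp
    also have "0 \<le> (1 / real (Suc n)) *\<^sub>R e" using e by (intro scaleR_nonneg_nonneg) auto
    finally show "step_approx e (Suc n) f - f \<le> (1 / real (Suc n)) *\<^sub>R e" .
    show "- (step_approx e (Suc n) f - f) \<le> (1 / real (Suc n)) *\<^sub>R e"
      using b(2) by (simp add: algebra_simps)
  qed
qed

section \<open>Bounded elements\<close>

lemma bounded_elementsI: "0 \<le> k \<Longrightarrow> \<bar>f\<bar> \<le> k *\<^sub>R e \<Longrightarrow> f \<in> bounded_elements e"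
  by (auto simp: bounded_elements_def)

lemma bounded_elementsE:
  assumes "f \<in> bounded_elements e" "0 \<le> e"
  obtains k where "0 < k" "\<bar>f\<bar> \<le> k *\<^sub>R e"
proof -
  obtain k where k: "0 \<le> k" "\<bar>f\<bar> \<le> k *\<^sub>R e"
    using assms by (auto simp: bounded_elements_def)
  have "k *\<^sub>R e \<le> (k + 1) *\<^sub>R e" using assms by (intro scaleR_right_mono) auto
  hence "\<bar>f\<bar> \<le> (k + 1) *\<^sub>R e" using k(2) by (rule order_trans[rotated])
  thus thesis using k(1) by (intro that[of "k + 1"]) auto
qed

lemma bounded_elements_solid:
  assumes "g \<in> bounded_elements e" "\<bar>f\<bar> \<le> \<bar>g\<bar>"
  shows "f \<in> bounded_elements e"
  using assms by (auto simp: bounded_elements_def intro: order_trans)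

lemma subspace_bounded_elements:
  fixes e :: "'a::dedekind_complete_riesz_space"
  shows "subspace (bounded_elements e)"
proof (rule subspaceI)
  show "0 \<in> bounded_elements e" by (rule bounded_elementsI[of 0]) auto
  fix x y :: 'a and c :: real
  assume x: "x \<in> bounded_elements e"
  then obtain k where k: "0 \<le> k" "\<bar>x\<bar> \<le> k *\<^sub>R e" by (auto simp: bounded_elements_def)
  have "\<bar>c\<bar> *\<^sub>R \<bar>x\<bar> \<le> \<bar>c\<bar> *\<^sub>R (k *\<^sub>R e)" by (rule scaleR_left_mono[OF k(2)]) simp
  thus "c *\<^sub>R x \<in> bounded_elements e"
    using k(1) by (intro bounded_elementsI[of "\<bar>c\<bar> * k"]) (auto simp: abs_scaleR)
  assume "y \<in> bounded_elements e"
  then obtain l where l: "0 \<le> l" "\<bar>y\<bar> \<le> l *\<^sub>R e" by (auto simp: bounded_elements_def)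
  have "\<bar>x + y\<bar> \<le> k *\<^sub>R e + l *\<^sub>R e"
    by (rule order_trans[OF abs_triangle_ineq add_mono[OF k(2) l(2)]])
  thus "x + y \<in> bounded_elements e"
    using k(1) l(1) by (intro bounded_elementsI[of "k + l"]) (auto simp: scaleR_add_left)
qed

lemmas bounded_elements_add = subspace_add[OF subspace_bounded_elements]
  and bounded_elements_diff = subspace_diff[OF subspace_bounded_elements]
  and bounded_elements_scale = subspace_scale[OF subspace_bounded_elements]
  and bounded_elements_neg = subspace_neg[OF subspace_bounded_elements]
  and bounded_elements_0 = subspace_0[OF subspace_bounded_elements]
  and bounded_elements_sum = subspace_sum[OF subspace_bounded_elements]

lemma bounded_elements_between:
  fixes e :: "'a::dedekind_complete_riesz_space"
  assumes "0 \<le> f" "f \<le> e"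
  shows "f \<in> bounded_elements e"
  using assms by (intro bounded_elementsI[of 1]) (auto simp: abs_of_nonneg)

lemma unit_in_bounded_elements: "0 \<le> e \<Longrightarrow> e \<in> bounded_elements e"
  by (rule bounded_elements_between) auto

lemma component_bounded: "component e p \<Longrightarrow> p \<in> bounded_elements e"
  using bounded_elements_between component_nonneg component_le by blast

text \<open>Freudenthal's theorem as an induction principle. A bounded element is brought into the order
interval from \<open>0\<close> to \<open>e\<close> by an affine change of scale, where step functions approximate it.\<close>

lemma bounded_elements_induct [consumes 2, case_names component add scale limit]:
  fixes e :: "'a::dedekind_complete_riesz_space"
  assumes "f \<in> bounded_elements e" "0 \<le> e"
    and component: "\<And>p. component e p \<Longrightarrow> Q p"
    and add: "\<And>f g. f \<in> bounded_elements e \<Longrightarrow> g \<in> bounded_elements e \<Longrightarrow>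
           Q f \<Longrightarrow> Q g \<Longrightarrow> Q (f + g)"
    and scale: "\<And>c f. f \<in> bounded_elements e \<Longrightarrow> Q f \<Longrightarrow> Q (c *\<^sub>R f)"
    and limit: "\<And>X f. range X \<subseteq> bounded_elements e \<Longrightarrow> f \<in> bounded_elements e \<Longrightarrow>
           order_tendsto X f \<Longrightarrow> (\<And>n. Q (X n)) \<Longrightarrow> Q f"
  shows "Q f"
proof -
  have zero: "Q 0"
    using assms(2) by (intro component) (simp add: component_def inf_absorb1)
  have sum: "Q (sum g A)"
    if "finite A" "\<And>i. i \<in> A \<Longrightarrow> g i \<in> bounded_elements e \<and> Q (g i)"
    for g :: "nat \<Rightarrow> 'a" and A
    using that by (induction A rule: finite_induct) (auto intro!: zero add bounded_elements_sum)
  have unit_interval: "Q g" if g: "0 \<le> g" "g \<le> e" for g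
  proof (rule limit)
    have c: "component e (principal_projection (pprt x) e)" for x
      by (rule component_principal_projection) (auto simp: assms(2))
    have b: "(\<Sum>j<N. principal_projection (pprt (x j)) e) \<in> bounded_elements e" for N and x :: "nat \<Rightarrow> 'a"
      by (intro bounded_elements_sum component_bounded c)
    show "range (\<lambda>n. step_approx e (Suc n) g) \<subseteq> bounded_elements e"
      unfolding step_approx_def by (intro image_subsetI bounded_elements_scale b)
    show "g \<in> bounded_elements e" using g by (rule bounded_elements_between)
    show "order_tendsto (\<lambda>n. step_approx e (Suc n) g) g" using g by (rule step_approx_tendsto)
    show "Q (step_approx e (Suc n) g)" for n
      unfolding step_approx_def
      by (intro scale b sum conjI component_bounded component c) simp
  qed
  obtain k where k: "0 < k" "\<bar>f\<bar> \<le> k *\<^sub>R e" using assms(1,2) by (rule bounded_elementsE)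
  define g where "g = (1 / (2 * k)) *\<^sub>R (f + k *\<^sub>R e)"
  have "- f \<le> k *\<^sub>R e" "f \<le> k *\<^sub>R e" using k(2) by (auto simp: abs_le_iff)
  hence "0 \<le> f + k *\<^sub>R e" "f + k *\<^sub>R e \<le> (2 * k) *\<^sub>R e"
    using add_left_mono[of "-f" "k *\<^sub>R e" f] add_right_mono[of f "k *\<^sub>R e" "k *\<^sub>R e"]
    by (simp_all flip: scaleR_add_left)
  hence "0 \<le> g" "(2 * k) *\<^sub>R g \<le> (2 * k) *\<^sub>R e"
    using k(1) by (simp_all add: g_def scaleR_nonneg_nonneg)
  hence g: "0 \<le> g" "g \<le> e" using k(1) by (auto simp: scaleR_le_cancel_left_pos)
  have "f = (2 * k) *\<^sub>R g + (- k) *\<^sub>R e" using k(1) by (simp add: g_def)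
  moreover have "Q ((2 * k) *\<^sub>R g + (- k) *\<^sub>R e)"
    using assms(2) g
    by (intro add scale unit_interval bounded_elements_scale bounded_elements_between) auto
  ultimately show ?thesis by metis
qed

section \<open>Squares\<close>

text \<open>The parabola \<open>x\<^sup>2\<close> is the supremum of its tangents \<open>2 a x - a\<^sup>2\<close>. Unlike the square itself, the
tangents make sense in a Riesz space with a distinguished element \<open>e\<close> in the role of \<open>1\<close>.\<close>

definition unit_square ::
    "'a::dedekind_complete_riesz_space \<Rightarrow> 'a \<Rightarrow> 'a" where
  "unit_square e f = (SUP a. (2 * a) *\<^sub>R f - (a\<^sup>2) *\<^sub>R e)"

lemma unit_square_least:
  "(\<And>a. (2 * a) *\<^sub>R f - (a\<^sup>2) *\<^sub>R e \<le> z) \<Longrightarrow> unit_square e f \<le> z"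
  unfolding unit_square_def by (rule cSUP_least) auto

lemma tangent_le:
  fixes e f :: "'a::dedekind_complete_riesz_space"
  assumes "0 \<le> e" "0 \<le> k" "\<bar>f\<bar> \<le> k *\<^sub>R e"
  shows "(2 * a) *\<^sub>R f - (a\<^sup>2) *\<^sub>R e \<le> (k\<^sup>2) *\<^sub>R e"
proof -
  have "(2 * a) *\<^sub>R f \<le> \<bar>2 * a\<bar> *\<^sub>R \<bar>f\<bar>"
    using abs_ge_self[of "(2 * a) *\<^sub>R f"] by (simp only: abs_scaleR)
  also have "\<dots> \<le> \<bar>2 * a\<bar> *\<^sub>R (k *\<^sub>R e)"
    using assms by (intro scaleR_left_mono) auto
  also have "\<dots> = (2 * \<bar>a\<bar> * k) *\<^sub>R e" by (simp add: abs_mult)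
  also have "\<dots> \<le> (k\<^sup>2 + a\<^sup>2) *\<^sub>R e"
  proof (rule scaleR_right_mono[OF _ assms(1)])
    show "2 * \<bar>a\<bar> * k \<le> k\<^sup>2 + a\<^sup>2"
      using sum_squares_bound[of "\<bar>a\<bar>" k] by (simp add: add.commute)
  qed
  finally show ?thesis by (simp add: scaleR_add_left diff_le_eq)
qed

lemma unit_square_upper:
  fixes e f :: "'a::dedekind_complete_riesz_space"
  assumes "0 \<le> e" "f \<in> bounded_elements e"
  shows "(2 * a) *\<^sub>R f - (a\<^sup>2) *\<^sub>R e \<le> unit_square e f"
proof -
  obtain k where k: "0 < k" "\<bar>f\<bar> \<le> k *\<^sub>R e" using assms(2,1) by (rule bounded_elementsE)
  have "bdd_above (range (\<lambda>a. (2 * a) *\<^sub>R f - (a\<^sup>2) *\<^sub>R e))"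
    using tangent_le[OF assms(1) less_imp_le[OF k(1)] k(2)] by (auto simp: bdd_above_def)
  thus ?thesis unfolding unit_square_def by (intro cSUP_upper) auto
qed

lemma unit_square_nonneg:
  assumes "0 \<le> e" "f \<in> bounded_elements e"
  shows "0 \<le> unit_square e f"
  using unit_square_upper[OF assms, of 0] by simp

lemma unit_square_le:
  assumes "0 \<le> e" "0 \<le> k" "\<bar>f\<bar> \<le> k *\<^sub>R e"
  shows "unit_square e f \<le> (k\<^sup>2) *\<^sub>R e"
  by (rule unit_square_least) (rule tangent_le[OF assms])

lemma unit_square_mono:
  fixes e f g :: "'a::dedekind_complete_riesz_space"
  assumes "0 \<le> e" "g \<in> bounded_elements e" "\<bar>f\<bar> \<le> g"
  shows "unit_square e f \<le> unit_square e g"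
proof (rule unit_square_least)
  fix a :: real
  have "(2 * a) *\<^sub>R f \<le> \<bar>2 * a\<bar> *\<^sub>R \<bar>f\<bar>"
    using abs_ge_self[of "(2 * a) *\<^sub>R f"] by (simp only: abs_scaleR)
  also have "\<dots> \<le> \<bar>2 * a\<bar> *\<^sub>R g" by (rule scaleR_left_mono[OF assms(3)]) simp
  finally have "(2 * a) *\<^sub>R f - (a\<^sup>2) *\<^sub>R e \<le> (2 * \<bar>a\<bar>) *\<^sub>R g - (\<bar>a\<bar>\<^sup>2) *\<^sub>R e"
    by (simp add: abs_mult)
  also have "\<dots> \<le> unit_square e g" by (rule unit_square_upper[OF assms(1,2)])
  finally show "(2 * a) *\<^sub>R f - (a\<^sup>2) *\<^sub>R e \<le> unit_square e g" .
qed

lemma unit_square_scale_le: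
  fixes e f :: "'a::dedekind_complete_riesz_space"
  assumes "0 \<le> e" "f \<in> bounded_elements e" "c \<noteq> 0"
  shows "unit_square e (c *\<^sub>R f) \<le> (c\<^sup>2) *\<^sub>R unit_square e f"
proof (rule unit_square_least)
  fix a :: real
  have "(2 * a) *\<^sub>R c *\<^sub>R f - (a\<^sup>2) *\<^sub>R e
      = (c\<^sup>2) *\<^sub>R ((2 * (a / c)) *\<^sub>R f - ((a / c)\<^sup>2) *\<^sub>R e)"
    using assms(3) by (simp add: scaleR_diff_right power2_eq_square)
  also have "\<dots> \<le> (c\<^sup>2) *\<^sub>R unit_square e f"
    by (intro scaleR_left_mono unit_square_upper assms) auto
  finally show "(2 * a) *\<^sub>R c *\<^sub>R f - (a\<^sup>2) *\<^sub>R e \<le> (c\<^sup>2) *\<^sub>R unit_square e f" .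
qed

lemma unit_square_scale:
  fixes e f :: "'a::dedekind_complete_riesz_space"
  assumes "0 \<le> e" "f \<in> bounded_elements e" "c \<noteq> 0"
  shows "unit_square e (c *\<^sub>R f) = (c\<^sup>2) *\<^sub>R unit_square e f"
proof (rule antisym)
  show "unit_square e (c *\<^sub>R f) \<le> (c\<^sup>2) *\<^sub>R unit_square e f"
    by (rule unit_square_scale_le[OF assms])
  have "unit_square e ((1 / c) *\<^sub>R c *\<^sub>R f) \<le> ((1 / c)\<^sup>2) *\<^sub>R unit_square e (c *\<^sub>R f)"
    using assms by (intro unit_square_scale_le bounded_elements_scale) auto
  hence "(c\<^sup>2) *\<^sub>R unit_square e f \<le> (c\<^sup>2) *\<^sub>R (((1 / c)\<^sup>2) *\<^sub>R unit_square e (c *\<^sub>R f))"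
    using assms(3) by (intro scaleR_left_mono) auto
  also have "\<dots> = unit_square e (c *\<^sub>R f)" using assms(3) by (simp add: power2_eq_square)
  finally show "(c\<^sup>2) *\<^sub>R unit_square e f \<le> unit_square e (c *\<^sub>R f)" .
qed

lemma unit_square_minus:
  assumes "0 \<le> e" "f \<in> bounded_elements e"
  shows "unit_square e (- f) = unit_square e f"
  using unit_square_scale[OF assms, of "-1"] by simp

lemma unit_square_0:
  assumes "0 \<le> e"
  shows "unit_square e 0 = 0"
proof (rule antisym)
  show "unit_square e 0 \<le> 0" using unit_square_le[OF assms, of 0 0] by simp
  show "0 \<le> unit_square e 0" by (rule unit_square_nonneg[OF assms bounded_elements_0])
qed

text \<open>The tangents of \<open>x + y\<close> at \<open>a\<close> and of \<open>x - y\<close> at \<open>b\<close> add up to twice the tangents of \<open>x\<close> at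
\<open>(a + b)/2\<close> and of \<open>y\<close> at \<open>(a - b)/2\<close>.\<close>

lemma parallelogram_le:
  fixes e x y :: "'a::dedekind_complete_riesz_space"
  assumes e: "0 \<le> e" and x: "x \<in> bounded_elements e" and y: "y \<in> bounded_elements e"
  shows "unit_square e (x + y) + unit_square e (x - y)
    \<le> 2 *\<^sub>R unit_square e x + 2 *\<^sub>R unit_square e y"
proof -
  let ?z = "2 *\<^sub>R unit_square e x + 2 *\<^sub>R unit_square e y"
  let ?t = "\<lambda>a f. (2 * a) *\<^sub>R f - (a\<^sup>2) *\<^sub>R e"
  have "?t a (x + y) + ?t b (x - y) \<le> ?z" for a b
  proof -
    have "2 * ((a + b) / 2)\<^sup>2 + 2 * ((a - b) / 2)\<^sup>2 = a\<^sup>2 + b\<^sup>2"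
      by (simp add: power2_eq_square field_simps)
    hence "(a\<^sup>2) *\<^sub>R e + (b\<^sup>2) *\<^sub>R e
        = 2 *\<^sub>R (((a + b) / 2)\<^sup>2) *\<^sub>R e + 2 *\<^sub>R (((a - b) / 2)\<^sup>2) *\<^sub>R e"
      by (simp flip: scaleR_add_left)
    moreover have "(2 * a) *\<^sub>R (x + y) + (2 * b) *\<^sub>R (x - y)
        = 2 *\<^sub>R (2 * ((a + b) / 2)) *\<^sub>R x + 2 *\<^sub>R (2 * ((a - b) / 2)) *\<^sub>R y"
    proof -
      have half: "2 * ((a + b) / 2) = a + b" "2 * ((a - b) / 2) = a - b" by simp_all
      show ?thesis unfolding half by (simp add: algebra_simps)
    qed
    ultimately have "?t a (x + y) + ?t b (x - y)
        = 2 *\<^sub>R ?t ((a + b) / 2) x + 2 *\<^sub>R ?t ((a - b) / 2) y"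
      unfolding scaleR_diff_right add_diff_add[symmetric] by (simp only:)
    also have "\<dots> \<le> ?z" by (intro add_mono scaleR_left_mono unit_square_upper e x y) auto
    finally show ?thesis .
  qed
  hence "?t a (x + y) \<le> ?z - ?t b (x - y)" for a b by (simp only: le_diff_eq)
  hence "unit_square e (x + y) \<le> ?z - ?t b (x - y)" for b by (rule unit_square_least)
  hence "?t b (x - y) \<le> ?z - unit_square e (x + y)" for b by (metis le_diff_eq add.commute)
  hence "unit_square e (x - y) \<le> ?z - unit_square e (x + y)" by (rule unit_square_least)
  thus ?thesis by (metis le_diff_eq add.commute)
qed

lemma parallelogram:
  fixes e x y :: "'a::dedekind_complete_riesz_space"
  assumes e: "0 \<le> e" and x: "x \<in> bounded_elements e" and y: "y \<in> bounded_elements e"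
  shows "unit_square e (x + y) + unit_square e (x - y)
    = 2 *\<^sub>R unit_square e x + 2 *\<^sub>R unit_square e y"
proof (rule antisym[OF parallelogram_le[OF assms]])
  \<comment> \<open>The reverse inequality is the same one for \<open>x + y\<close> and \<open>x - y\<close>, since \<open>(2 x)\<^sup>2 = 4 x\<^sup>2\<close>.\<close>
  have "unit_square e ((x + y) + (x - y)) + unit_square e ((x + y) - (x - y))
      \<le> 2 *\<^sub>R unit_square e (x + y) + 2 *\<^sub>R unit_square e (x - y)"
    using e x y by (intro parallelogram_le bounded_elements_add bounded_elements_diff)
  moreover have "(x + y) + (x - y) = 2 *\<^sub>R x" "(x + y) - (x - y) = 2 *\<^sub>R y"
    by (simp_all add: scaleR_2)
  ultimately have "4 *\<^sub>R unit_square e x + 4 *\<^sub>R unit_square e y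
      \<le> 2 *\<^sub>R unit_square e (x + y) + 2 *\<^sub>R unit_square e (x - y)"
    using unit_square_scale[OF e x, of 2] unit_square_scale[OF e y, of 2] by simp
  hence "2 *\<^sub>R (2 *\<^sub>R unit_square e x + 2 *\<^sub>R unit_square e y)
      \<le> 2 *\<^sub>R (unit_square e (x + y) + unit_square e (x - y))"
    by (simp add: scaleR_add_right)
  thus "2 *\<^sub>R unit_square e x + 2 *\<^sub>R unit_square e y
      \<le> unit_square e (x + y) + unit_square e (x - y)"
    by (simp only: scaleR_le_cancel_left_pos zero_less_numeral)
qed

text \<open>\<open>(f + e)\<^sup>2 = f\<^sup>2 + 2 f + e\<close>, by shifting the parameter of the tangents by one; this makes \<open>e\<close> the
unit of the product.\<close>

lemma unit_square_add_unit_le: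
  fixes e f :: "'a::dedekind_complete_riesz_space"
  assumes "0 \<le> e" "f \<in> bounded_elements e"
  shows "unit_square e (f + e) \<le> unit_square e f + 2 *\<^sub>R f + e"
proof (rule unit_square_least)
  fix a :: real
  have "2 * a - a\<^sup>2 = 1 - (a - 1)\<^sup>2" by (simp add: power2_eq_square algebra_simps)
  hence "(2 * a) *\<^sub>R e - (a\<^sup>2) *\<^sub>R e = e - ((a - 1)\<^sup>2) *\<^sub>R e"
    by (simp flip: scaleR_diff_left add: scaleR_diff_left[of 1, simplified])
  hence "(2 * a) *\<^sub>R (f + e) - (a\<^sup>2) *\<^sub>R e
      = ((2 * (a - 1)) *\<^sub>R f - ((a - 1)\<^sup>2) *\<^sub>R e) + 2 *\<^sub>R f + e"
    by (simp add: scaleR_add_right right_diff_distrib scaleR_diff_left algebra_simps)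
  also have "\<dots> \<le> unit_square e f + 2 *\<^sub>R f + e"
    by (intro add_mono order_refl unit_square_upper assms)
  finally show "(2 * a) *\<^sub>R (f + e) - (a\<^sup>2) *\<^sub>R e \<le> unit_square e f + 2 *\<^sub>R f + e" .
qed

lemma unit_square_add_unit:
  fixes e f :: "'a::dedekind_complete_riesz_space"
  assumes e: "0 \<le> e" and f: "f \<in> bounded_elements e"
  shows "unit_square e (f + e) = unit_square e f + 2 *\<^sub>R f + e"
proof (rule antisym[OF unit_square_add_unit_le[OF assms]])
  have "unit_square e (- (f + e) + e) \<le> unit_square e (- (f + e)) + 2 *\<^sub>R (- (f + e)) + e"
    using e f by (intro unit_square_add_unit_le bounded_elements_neg bounded_elements_add
        unit_in_bounded_elements)
  moreover have "unit_square e (- (f + e)) = unit_square e (f + e)"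
    using e f by (intro unit_square_minus bounded_elements_add unit_in_bounded_elements)
  ultimately have "unit_square e f \<le> unit_square e (f + e) - 2 *\<^sub>R f - e"
    using unit_square_minus[OF e f] by (simp add: scaleR_2 algebra_simps)
  thus "unit_square e f + 2 *\<^sub>R f + e \<le> unit_square e (f + e)"
    by (simp add: algebra_simps)
qed

section \<open>The product\<close>

text \<open>The value \<open>0\<close> off the bounded elements is the one that \<^const>\<open>is_unit_mult\<close> prescribes there.\<close>

definition unit_product ::
    "'a::dedekind_complete_riesz_space \<Rightarrow> 'a \<Rightarrow> 'a \<Rightarrow> 'a" where
  "unit_product e f g =
     (if f \<in> bounded_elements e \<and> g \<in> bounded_elements e
      then (1 / 4) *\<^sub>R (unit_square e (f + g) - unit_square e (f - g)) else 0)"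

lemma unit_product_eq:
  "f \<in> bounded_elements e \<Longrightarrow> g \<in> bounded_elements e \<Longrightarrow>
   unit_product e f g = (1 / 4) *\<^sub>R (unit_square e (f + g) - unit_square e (f - g))"
  by (simp add: unit_product_def)

lemma unit_product_self:
  assumes "0 \<le> e" "f \<in> bounded_elements e"
  shows "unit_product e f f = unit_square e f"
  using unit_square_scale[OF assms, of 2] unit_square_0[OF assms(1)] assms
  by (simp add: unit_product_eq scaleR_2[symmetric])

lemma unit_product_commute:
  assumes "0 \<le> e"
  shows "unit_product e f g = unit_product e g f"
proof (cases "f \<in> bounded_elements e \<and> g \<in> bounded_elements e")
  case True
  hence "unit_square e (- (f - g)) = unit_square e (f - g)"
    using assms by (intro unit_square_minus bounded_elements_diff) auto
  thus ?thesis using True by (simp add: unit_product_eq add.commute)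
qed (auto simp: unit_product_def)

text \<open>The argument of Jordan and von Neumann: the parallelogram law gives
\<open>B (x + y) + B (x - y) = 2 B x\<close> for \<open>B x = (x + h)\<^sup>2 - (x - h)\<^sup>2\<close>. Evaluate at half the sum and
half the difference of \<open>f\<close> and \<open>g\<close>.\<close>

lemma unit_product_add_left:
  fixes e f g h :: "'a::dedekind_complete_riesz_space"
  assumes e: "0 \<le> e" and f: "f \<in> bounded_elements e" and g: "g \<in> bounded_elements e"
    and h: "h \<in> bounded_elements e"
  shows "unit_product e (f + g) h = unit_product e f h + unit_product e g h"
proof -
  define B where "B x = unit_square e (x + h) - unit_square e (x - h)" for x
  have half: "B (x + y) + B (x - y) = 2 *\<^sub>R B x"
    if x: "x \<in> bounded_elements e" and y: "y \<in> bounded_elements e" for x y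
  proof -
    have "unit_square e (x + h + y) + unit_square e (x + h - y)
        = 2 *\<^sub>R unit_square e (x + h) + 2 *\<^sub>R unit_square e y"
      by (intro parallelogram e bounded_elements_add x y h)
    moreover have "unit_square e (x - h + y) + unit_square e (x - h - y)
        = 2 *\<^sub>R unit_square e (x - h) + 2 *\<^sub>R unit_square e y"
      by (intro parallelogram e bounded_elements_diff x y h)
    moreover have "x + h + y = x + y + h" "x + h - y = x - y + h"
        "x - h + y = x + y - h" "x - h - y = x - y - h"
      by simp_all
    ultimately show ?thesis
      unfolding B_def scaleR_diff_right
      by (metis (no_types, lifting) add_diff_add add_diff_cancel_right)
  qed
  have "B 0 = 0" using unit_square_minus[OF e h] by (simp add: B_def)
  hence double: "B (2 *\<^sub>R x) = 2 *\<^sub>R B x" if "x \<in> bounded_elements e" for x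
    using half[OF that that] by (simp add: scaleR_2)
  let ?x = "(1/2) *\<^sub>R (f + g)" and ?y = "(1/2) *\<^sub>R (f - g)"
  have m: "?x \<in> bounded_elements e" "?y \<in> bounded_elements e"
    using f g by (auto intro: bounded_elements_scale bounded_elements_add bounded_elements_diff)
  have "?x + ?y = f" "?x - ?y = g" "2 *\<^sub>R ?x = f + g"
    by (simp_all flip: scaleR_add_right scaleR_diff_right)
  hence "B (f + g) = B f + B g" using half[OF m] double[OF m(1)] by simp
  thus ?thesis
    using f g h by (simp add: unit_product_eq bounded_elements_add B_def flip: scaleR_add_right)
qed

lemma unit_product_nonneg:
  fixes e f g :: "'a::dedekind_complete_riesz_space"
  assumes e: "0 \<le> e" and "0 \<le> f" "0 \<le> g"
  shows "0 \<le> unit_product e f g"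
proof (cases "f \<in> bounded_elements e \<and> g \<in> bounded_elements e")
  case True
  have "\<bar>f - g\<bar> \<le> f + g"
  proof (rule abs_leI)
    show "f - g \<le> f + g" using assms by (simp add: diff_le_eq add.assoc)
    show "- (f - g) \<le> f + g" using assms by (simp add: diff_le_eq add_increasing2 algebra_simps)
  qed
  hence "unit_square e (f - g) \<le> unit_square e (f + g)"
    using e True by (intro unit_square_mono bounded_elements_add) auto
  thus ?thesis using True by (auto simp: unit_product_eq intro!: scaleR_nonneg_nonneg)
qed (auto simp: unit_product_def)

text \<open>The defect \<open>z = A (c f) - c A f\<close> for \<open>c \<ge> 0\<close> has bounded multiples: in \<open>n z\<close> the integral part of
\<open>n c\<close> cancels by additivity, and only the fractional part remains. So \<open>z = 0\<close> by the
Archimedean property.\<close>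

lemma additive_bounded_homogeneous:
  fixes A :: "'a::dedekind_complete_riesz_space \<Rightarrow> 'a"
  assumes E: "subspace E" and f: "f \<in> E"
    and add: "\<And>x y. x \<in> E \<Longrightarrow> y \<in> E \<Longrightarrow> A (x + y) = A x + A y"
    and bound: "\<And>r. 0 \<le> r \<Longrightarrow> r \<le> 1 \<Longrightarrow> \<bar>A (r *\<^sub>R f)\<bar> \<le> K"
  shows "A (c *\<^sub>R f) = c *\<^sub>R A f"
proof -
  have A0: "A 0 = 0" using add[of 0 0] subspace_0[OF E] by simp
  have minus: "A (- x) = - A x" if "x \<in> E" for x
    using add[of x "- x"] A0 that subspace_neg[OF E that] by (simp add: eq_neg_iff_add_eq_0 add.commute)
  have nat: "A (real n *\<^sub>R x) = real n *\<^sub>R A x" if "x \<in> E" for n x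
  proof (induction n)
    case (Suc n)
    have "A (x + real n *\<^sub>R x) = A x + A (real n *\<^sub>R x)"
      by (intro add that subspace_scale[OF E])
    thus ?case using Suc by (simp add: scaleR_add_left)
  qed (simp add: A0)
  have nonneg: "A (c *\<^sub>R f) = c *\<^sub>R A f" if c: "0 \<le> c" for c
  proof -
    let ?z = "A (c *\<^sub>R f) - c *\<^sub>R A f"
    have bnd: "\<bar>real n *\<^sub>R ?z\<bar> \<le> K + K" for n :: nat
    proof -
      define j where "j = nat \<lfloor>real n * c\<rfloor>"
      define r where "r = real n * c - real j"
      have "real j = of_int \<lfloor>real n * c\<rfloor>" using c by (simp add: j_def)
      hence r: "0 \<le> r" "r \<le> 1" by (simp_all add: r_def) linarith
      have "real n *\<^sub>R A (c *\<^sub>R f) = A (real n *\<^sub>R c *\<^sub>R f)"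
        by (rule nat[symmetric]) (rule subspace_scale[OF E f])
      also have "real n *\<^sub>R c *\<^sub>R f = real j *\<^sub>R f + r *\<^sub>R f"
        by (simp add: r_def flip: scaleR_add_left)
      also have "A \<dots> = real j *\<^sub>R A f + A (r *\<^sub>R f)"
        by (simp add: add nat f subspace_scale[OF E])
      finally have "real n *\<^sub>R ?z = A (r *\<^sub>R f) - r *\<^sub>R A f"
        by (simp add: scaleR_diff_right r_def scaleR_diff_left)
      moreover have "\<bar>r *\<^sub>R A f\<bar> \<le> K"
      proof -
        have "\<bar>r *\<^sub>R A f\<bar> = r *\<^sub>R \<bar>A f\<bar>" using r by (simp add: abs_scaleR_nonneg)
        also have "\<dots> \<le> 1 *\<^sub>R \<bar>A f\<bar>" using r by (intro scaleR_right_mono) auto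
        also have "\<dots> \<le> K" using bound[of 1] by simp
        finally show ?thesis .
      qed
      ultimately show ?thesis
        using order_trans[OF abs_triangle_ineq4 add_mono[OF bound[OF r]]] by simp
    qed
    have "real n *\<^sub>R ?z \<le> K + K" "real n *\<^sub>R (- ?z) \<le> K + K" for n :: nat
      using bnd[of n] by (simp_all only: abs_le_iff scaleR_minus_right)
    hence "?z \<le> 0" "- ?z \<le> 0" by (blast intro: archimedean_scaleR)+
    thus ?thesis by (simp add: antisym)
  qed
  show ?thesis
  proof (cases "0 \<le> c")
    case False
    hence "A (- ((- c) *\<^sub>R f)) = - ((- c) *\<^sub>R A f)"
      using minus[OF subspace_scale[OF E f]] nonneg[of "- c"] by simp
    thus ?thesis by simp
  qed (rule nonneg)
qed

text \<open>Read off from the bounds for squares; it supplies the boundedness from which homogeneity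
follows.\<close>

lemma unit_product_abs_le_unit:
  fixes e f g :: "'a::dedekind_complete_riesz_space"
  assumes e: "0 \<le> e" and k: "0 \<le> k" "\<bar>f\<bar> \<le> k *\<^sub>R e" and l: "0 \<le> l" "\<bar>g\<bar> \<le> l *\<^sub>R e"
  shows "\<bar>unit_product e f g\<bar> \<le> ((k + l)\<^sup>2) *\<^sub>R e"
proof -
  have b: "f \<in> bounded_elements e" "g \<in> bounded_elements e"
    using k l by (auto intro: bounded_elementsI)
  have sum: "\<bar>f\<bar> + \<bar>g\<bar> \<le> (k + l) *\<^sub>R e"
    using add_mono[OF k(2) l(2)] by (simp add: scaleR_add_left)
  have le: "unit_square e (f + g) \<le> ((k + l)\<^sup>2) *\<^sub>R e" "unit_square e (f - g) \<le> ((k + l)\<^sup>2) *\<^sub>R e"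
    using order_trans[OF abs_triangle_ineq sum] order_trans[OF abs_triangle_ineq4 sum] e k(1) l(1)
    by (auto intro!: unit_square_le)
  have nn: "0 \<le> unit_square e (f + g)" "0 \<le> unit_square e (f - g)"
    using e b by (auto intro!: unit_square_nonneg bounded_elements_add bounded_elements_diff)
  have "\<bar>unit_square e (f + g) - unit_square e (f - g)\<bar> \<le> ((k + l)\<^sup>2) *\<^sub>R e"
    using le nn by (intro abs_leI) (auto simp: diff_le_eq intro: add_increasing2)
  hence "(1/4) *\<^sub>R \<bar>unit_square e (f + g) - unit_square e (f - g)\<bar> \<le> (1/4) *\<^sub>R ((k + l)\<^sup>2) *\<^sub>R e"
    by (rule scaleR_left_mono) simp
  also have "\<dots> \<le> 1 *\<^sub>R ((k + l)\<^sup>2) *\<^sub>R e"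
    using e by (intro scaleR_right_mono scaleR_nonneg_nonneg) auto
  finally show ?thesis using b by (simp add: unit_product_eq abs_scaleR_nonneg)
qed

lemma unit_product_scale_left:
  fixes e f g :: "'a::dedekind_complete_riesz_space"
  assumes e: "0 \<le> e" and f: "f \<in> bounded_elements e" and g: "g \<in> bounded_elements e"
  shows "unit_product e (c *\<^sub>R f) g = c *\<^sub>R unit_product e f g"
proof -
  obtain k where k: "0 < k" "\<bar>f\<bar> \<le> k *\<^sub>R e" using f e by (rule bounded_elementsE)
  obtain l where l: "0 < l" "\<bar>g\<bar> \<le> l *\<^sub>R e" using g e by (rule bounded_elementsE)
  show ?thesis
  proof (rule additive_bounded_homogeneous[OF subspace_bounded_elements f, where A = "\<lambda>x. unit_product e x g"])
    show "\<bar>unit_product e (r *\<^sub>R f) g\<bar> \<le> ((k + l)\<^sup>2) *\<^sub>R e" if r: "0 \<le> r" "r \<le> 1" for r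
    proof (rule unit_product_abs_le_unit)
      have "r *\<^sub>R \<bar>f\<bar> \<le> 1 *\<^sub>R \<bar>f\<bar>" using r by (intro scaleR_right_mono) auto
      thus "\<bar>r *\<^sub>R f\<bar> \<le> k *\<^sub>R e" using r k by (simp add: abs_scaleR_nonneg)
    qed (use e k l in auto)
  qed (rule unit_product_add_left[OF e _ _ g])
qed

lemma unit_product_add_right:
  assumes "0 \<le> e" "f \<in> bounded_elements e" "g \<in> bounded_elements e" "h \<in> bounded_elements e"
  shows "unit_product e h (f + g) = unit_product e h f + unit_product e h g"
  using unit_product_add_left[OF assms] by (simp only: unit_product_commute[OF assms(1), of h])

lemma unit_product_scale_right:
  assumes "0 \<le> e" "f \<in> bounded_elements e" "g \<in> bounded_elements e"
  shows "unit_product e f (c *\<^sub>R g) = c *\<^sub>R unit_product e f g"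
  using unit_product_scale_left[OF assms(1,3,2)]
  by (simp only: unit_product_commute[OF assms(1), of f])

lemma unit_product_minus_left:
  assumes "0 \<le> e" "f \<in> bounded_elements e" "g \<in> bounded_elements e"
  shows "unit_product e (- f) g = - unit_product e f g"
  using unit_product_scale_left[OF assms, of "-1"] by simp

lemma unit_product_diff_left:
  assumes "0 \<le> e" "f \<in> bounded_elements e" "g \<in> bounded_elements e" "h \<in> bounded_elements e"
  shows "unit_product e (f - g) h = unit_product e f h - unit_product e g h"
  using unit_product_add_left[OF assms(1,2) bounded_elements_neg[OF assms(3)] assms(4)]
    unit_product_minus_left[OF assms(1,3,4)] by simp

lemma unit_product_diff_right:
  assumes "0 \<le> e" "f \<in> bounded_elements e" "g \<in> bounded_elements e" "h \<in> bounded_elements e"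
  shows "unit_product e h (f - g) = unit_product e h f - unit_product e h g"
  using unit_product_diff_left[OF assms] by (simp only: unit_product_commute[OF assms(1), of h])

lemma unit_product_mono:
  fixes e f g :: "'a::dedekind_complete_riesz_space"
  assumes e: "0 \<le> e" and b: "f' \<in> bounded_elements e" "g' \<in> bounded_elements e"
    and f: "0 \<le> f" "f \<le> f'" and g: "0 \<le> g" "g \<le> g'"
  shows "unit_product e f g \<le> unit_product e f' g'"
proof -
  have b': "f \<in> bounded_elements e" "g \<in> bounded_elements e"
    using b f g order_trans[OF f] order_trans[OF g]
    by (auto intro!: bounded_elements_solid[of f' e f] bounded_elements_solid[of g' e g])
  have "0 \<le> unit_product e (f' - f) g'" "0 \<le> unit_product e f (g' - g)"
    using f g order_trans[OF g] by (auto intro!: unit_product_nonneg e)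
  hence "unit_product e f g' \<le> unit_product e f' g'" "unit_product e f g \<le> unit_product e f g'"
    using b b' e by (simp_all add: unit_product_diff_left unit_product_diff_right)
  thus ?thesis by (rule order_trans[rotated])
qed

lemma unit_product_unit_right:
  fixes e f :: "'a::dedekind_complete_riesz_space"
  assumes e: "0 \<le> e" and f: "f \<in> bounded_elements e"
  shows "unit_product e f e = f"
proof -
  have "unit_square e (- (- f + e)) = unit_square e (- f + e)"
    using e f by (intro unit_square_minus bounded_elements_add bounded_elements_neg
        unit_in_bounded_elements)
  hence "unit_square e (f - e) = unit_square e f - 2 *\<^sub>R f + e"
    using unit_square_add_unit[OF e bounded_elements_neg[OF f]] unit_square_minus[OF e f] by simp
  hence "unit_square e (f + e) - unit_square e (f - e) = 2 *\<^sub>R f + 2 *\<^sub>R f"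
    using unit_square_add_unit[OF e f] by simp
  also have "\<dots> = 4 *\<^sub>R f" by (simp flip: scaleR_add_left)
  finally show ?thesis using e f by (simp add: unit_product_eq unit_in_bounded_elements)
qed

text \<open>For \<open>f \<ge> 0\<close> this is positivity of \<open>f \<cdot> (l e - g)\<close> and \<open>f \<cdot> (l e + g)\<close>; the general case follows
by splitting \<open>f\<close> into its positive and negative part.\<close>

lemma unit_product_abs_le:
  fixes e f g :: "'a::dedekind_complete_riesz_space"
  assumes e: "0 \<le> e" and f: "f \<in> bounded_elements e" and l: "0 \<le> l" "\<bar>g\<bar> \<le> l *\<^sub>R e"
  shows "\<bar>unit_product e f g\<bar> \<le> l *\<^sub>R \<bar>f\<bar>"
proof -
  note ebd = unit_in_bounded_elements[OF e]
  have g: "g \<in> bounded_elements e" using l by (rule bounded_elementsI)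
  have pos: "\<bar>unit_product e x g\<bar> \<le> l *\<^sub>R x" if x: "0 \<le> x" "x \<in> bounded_elements e" for x
  proof -
    have "0 \<le> unit_product e x (l *\<^sub>R e - g)" "0 \<le> unit_product e x (l *\<^sub>R e - (- g))"
      using l(2) x(1) by (simp_all only: unit_product_nonneg e diff_ge_0_iff_ge abs_le_iff)
    hence "0 \<le> l *\<^sub>R x - unit_product e x g" "0 \<le> l *\<^sub>R x - (- unit_product e x g)"
      using unit_product_minus_left[OF e g x(2)] e x g ebd
      by (simp_all add: unit_product_diff_right unit_product_scale_right unit_product_unit_right
          bounded_elements_scale bounded_elements_neg unit_product_add_right)
    thus ?thesis by (intro abs_leI) (simp_all only: diff_ge_0_iff_ge)
  qed
  have "pprt f \<in> bounded_elements e" "- nprt f \<in> bounded_elements e"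
    using pprt_le_abs[of f] neg_nprt_le_abs[of f]
    by (auto intro!: bounded_elements_solid[OF f] simp: abs_of_nonneg simp del: abs_minus_cancel)
  note parts = this
  have "f = pprt f - (- nprt f)" by (simp flip: prts)
  hence "unit_product e f g = unit_product e (pprt f) g - unit_product e (- nprt f) g"
    using unit_product_diff_left[OF e parts g] by simp
  hence "\<bar>unit_product e f g\<bar> \<le> \<bar>unit_product e (pprt f) g\<bar> + \<bar>unit_product e (- nprt f) g\<bar>"
    by (simp only: abs_triangle_ineq4)
  also have "\<dots> \<le> l *\<^sub>R pprt f + l *\<^sub>R (- nprt f)"
    by (intro add_mono pos parts) auto
  also have "\<dots> = l *\<^sub>R \<bar>f\<bar>" by (simp add: abs_prts scaleR_diff_right)
  finally show ?thesis .
qed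

lemma unit_product_in_bounded:
  fixes e :: "'a::dedekind_complete_riesz_space"
  assumes e: "0 \<le> e" and f: "f \<in> bounded_elements e" and g: "g \<in> bounded_elements e"
  shows "unit_product e f g \<in> bounded_elements e"
proof -
  obtain l where l: "0 < l" "\<bar>g\<bar> \<le> l *\<^sub>R e" using g e by (rule bounded_elementsE)
  have "\<bar>unit_product e f g\<bar> \<le> \<bar>l *\<^sub>R f\<bar>"
    using unit_product_abs_le[OF e f less_imp_le[OF l(1)] l(2)] l(1) by (simp add: abs_scaleR_nonneg)
  thus ?thesis by (rule bounded_elements_solid[OF bounded_elements_scale[OF f]])
qed

text \<open>The tangents at \<open>0\<close> and \<open>1\<close> suffice: \<open>2 p - e\<close> equals \<open>p - (e - p)\<close>, a difference of disjoint
elements, so its positive part is \<open>p\<close>.\<close>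

lemma component_le_unit_square:
  fixes e p :: "'a::dedekind_complete_riesz_space"
  assumes "component e p"
  shows "p \<le> unit_square e p"
proof -
  have e: "0 \<le> e" and b: "p \<in> bounded_elements e"
    using assms component_unit_nonneg component_bounded by blast+
  have "2 *\<^sub>R p - e \<le> unit_square e p" using unit_square_upper[OF e b, of 1] by simp
  moreover have "0 \<le> unit_square e p" by (rule unit_square_nonneg[OF e b])
  moreover have "p = sup 0 (2 *\<^sub>R p - e)"
  proof -
    have "p - inf p (e - p) = p + sup (- p) (p - e)"
      by (simp only: diff_conv_add_uminus neg_inf_eq_sup minus_add_distrib minus_minus add.commute)
    also have "\<dots> = sup 0 (2 *\<^sub>R p - e)"
      by (simp add: add_sup_distrib_left scaleR_2 add_diff_eq)
    finally show ?thesis using assms by (simp only: component_def diff_0_right)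
  qed
  ultimately show ?thesis by (metis sup_least)
qed

text \<open>Comparison with the products \<open>p \<cdot> e\<close> and \<open>e \<cdot> q\<close> from above and with the square of the component
\<open>p \<and> q\<close> from below.\<close>

lemma unit_product_components:
  fixes e p q :: "'a::dedekind_complete_riesz_space"
  assumes p: "component e p" and q: "component e q"
  shows "unit_product e p q = inf p q"
proof (rule antisym)
  have e: "0 \<le> e" by (rule component_unit_nonneg[OF p])
  note b = component_bounded[OF p] component_bounded[OF q] unit_in_bounded_elements[OF e]
  note pos = component_nonneg[OF p] component_nonneg[OF q]
  have "unit_product e p q \<le> unit_product e p e" "unit_product e p q \<le> unit_product e e q"
    by (intro unit_product_mono e b pos order_refl component_le p q)+
  thus "unit_product e p q \<le> inf p q"
    using b unit_product_commute[OF e, of e q] by (simp add: unit_product_unit_right[OF e])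
  let ?r = "inf p q"
  have r: "component e ?r" by (rule component_inf[OF p q])
  have "?r \<le> unit_square e ?r" by (rule component_le_unit_square[OF r])
  also have "\<dots> = unit_product e ?r ?r"
    by (rule unit_product_self[OF e component_bounded[OF r], symmetric])
  also have "\<dots> \<le> unit_product e p q"
    by (intro unit_product_mono e b component_nonneg[OF r] inf_le1 inf_le2)
  finally show "?r \<le> unit_product e p q" .
qed

text \<open>The dominating sequence \<open>v\<close> of \<open>X\<close> need not be bounded by multiples of \<open>e\<close>. This is harmless,
because \<open>\<bar>(X n - x) \<cdot> g\<bar> \<le> l \<bar>X n - x\<bar>\<close> holds in the whole space.\<close>

lemma unit_product_order_tendsto:
  fixes e x g :: "'a::dedekind_complete_riesz_space"
  assumes e: "0 \<le> e" and X: "range X \<subseteq> bounded_elements e" and x: "x \<in> bounded_elements e"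
    and lim: "order_tendsto X x" and g: "g \<in> bounded_elements e"
  shows "order_tendsto (\<lambda>n. unit_product e (X n) g) (unit_product e x g)"
proof -
  obtain v where v: "decseq v" "\<forall>n. \<bar>X n - x\<bar> \<le> v n" "\<forall>z. (\<forall>n. z \<le> v n) \<longrightarrow> z \<le> 0"
    using order_tendstoE[OF lim] by blast
  obtain l where l: "0 < l" "\<bar>g\<bar> \<le> l *\<^sub>R e" using g e by (rule bounded_elementsE)
  show ?thesis
  proof (rule order_tendstoI)
    show "decseq (\<lambda>n. l *\<^sub>R v n)"
      using v(1) l(1) by (auto simp: decseq_def intro!: scaleR_left_mono)
    fix n
    have Xn: "X n \<in> bounded_elements e" using X by blast
    have "\<bar>unit_product e (X n - x) g\<bar> \<le> l *\<^sub>R \<bar>X n - x\<bar>"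
      using l by (intro unit_product_abs_le e bounded_elements_diff Xn x) auto
    also have "\<dots> \<le> l *\<^sub>R v n" using v(2) l(1) by (intro scaleR_left_mono) auto
    finally show "\<bar>unit_product e (X n) g - unit_product e x g\<bar> \<le> l *\<^sub>R v n"
      by (simp only: unit_product_diff_left[OF e Xn x g])
  next
    fix z assume z: "\<And>n. z \<le> l *\<^sub>R v n"
    have "inverse l *\<^sub>R z \<le> v n" for n
      using scaleR_left_mono[OF z, of "inverse l" n] l(1) by simp
    hence "inverse l *\<^sub>R z \<le> 0" using v(3) by blast
    hence "l *\<^sub>R (inverse l *\<^sub>R z) \<le> l *\<^sub>R 0" using l(1) by (intro scaleR_left_mono) auto
    thus "z \<le> 0" using l(1) by simp
  qed
qed

lemma is_unit_mult_unit_product: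
  fixes e :: "'a::dedekind_complete_riesz_space"
  assumes e: "0 \<le> e"
  shows "is_unit_mult e (unit_product e)"
proof -
  have "unit_product e (P e) (Q e) = P (Q e)" if "band_projection P" "band_projection Q" for P Q
    using unit_product_components[OF band_projection_component[OF that(1) e]
        band_projection_component[OF that(2) e]] band_projection_comp_unit[OF that e] by simp
  moreover have "order_tendsto (\<lambda>n. unit_product e g (X n)) (unit_product e g x)"
    if "range X \<subseteq> bounded_elements e" "x \<in> bounded_elements e" "order_tendsto X x"
      "g \<in> bounded_elements e" for X x g
    using unit_product_order_tendsto[OF e that] by (simp only: unit_product_commute[OF e, of g])
  moreover have "unit_product e f g = 0"
    if "f \<notin> bounded_elements e \<or> g \<notin> bounded_elements e" for f g
    using that by (auto simp: unit_product_def)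
  ultimately show ?thesis
    unfolding is_unit_mult_def Let_def
    by (intro conjI ballI allI impI)
      (simp_all add: e unit_product_in_bounded unit_product_add_left unit_product_add_right
        unit_product_scale_left unit_product_scale_right unit_product_order_tendsto)
qed

text \<open>Two candidates agree on pairs of components; Freudenthal induction extends this first in the left
and then in the right argument.\<close>

lemma is_unit_mult_unique:
  fixes e :: "'a::dedekind_complete_riesz_space"
  assumes e: "0 \<le> e" and m: "is_unit_mult e m" and m': "is_unit_mult e m'"
  shows "m = m'"
proof (intro ext)
  let ?E = "bounded_elements e"
  have m_add: "\<mu> (f + g) h = \<mu> f h + \<mu> g h" "\<mu> h (f + g) = \<mu> h f + \<mu> h g"
    if "is_unit_mult e \<mu>" "f \<in> ?E" "g \<in> ?E" "h \<in> ?E" for \<mu> f g h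
    using that unfolding is_unit_mult_def Let_def by blast+
  have m_scale: "\<mu> (c *\<^sub>R f) g = c *\<^sub>R \<mu> f g" "\<mu> f (c *\<^sub>R g) = c *\<^sub>R \<mu> f g"
    if "is_unit_mult e \<mu>" "f \<in> ?E" "g \<in> ?E" for \<mu> f g c
    using that unfolding is_unit_mult_def Let_def by blast+
  have m_lim: "order_tendsto (\<lambda>n. \<mu> (X n) g) (\<mu> x g)" "order_tendsto (\<lambda>n. \<mu> g (X n)) (\<mu> g x)"
    if "is_unit_mult e \<mu>" "range X \<subseteq> ?E" "x \<in> ?E" "order_tendsto X x" "g \<in> ?E" for \<mu> X x g
    using that unfolding is_unit_mult_def Let_def by blast+
  have proj: "\<mu> (P e) (Q e) = P (Q e)"
    if "is_unit_mult e \<mu>" "band_projection P" "band_projection Q" for \<mu> P Q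
    using that unfolding is_unit_mult_def Let_def by blast
  have comp: "m p q = m' p q" if pq: "component e p" "component e q" for p q
  proof -
    obtain P Q where P: "band_projection P" "P e = p" and Q: "band_projection Q" "Q e = q"
      using component_band_projection pq by metis
    show ?thesis using proj[OF m P(1) Q(1)] proj[OF m' P(1) Q(1)] P(2) Q(2) by simp
  qed
  have left: "m f q = m' f q" if f: "f \<in> ?E" and q: "component e q" for f q
    using f e
  proof (induction f rule: bounded_elements_induct)
    case (component p)
    thus ?case using q by (rule comp)
  next
    case (add f g)
    thus ?case using component_bounded[OF q] m_add(1)[OF m] m_add(1)[OF m'] by metis
  next
    case (scale c f)
    thus ?case using component_bounded[OF q] m_scale(1)[OF m] m_scale(1)[OF m'] by metis
  next
    case (limit X f)
    note b = limit(1,2,3) component_bounded[OF q]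
    show ?case
      using m_lim(1)[OF m b] m_lim(1)[OF m' b] unfolding limit(4) by (rule order_tendsto_unique)
  qed
  have both: "m f g = m' f g" if g: "g \<in> ?E" and f: "f \<in> ?E" for f g
    using g e
  proof (induction g rule: bounded_elements_induct)
    case (component q)
    show ?case by (rule left[OF f component])
  next
    case (add g h)
    thus ?case using f m_add(2)[OF m] m_add(2)[OF m'] by metis
  next
    case (scale c g)
    thus ?case using f m_scale(2)[OF m] m_scale(2)[OF m'] by metis
  next
    case (limit X g)
    note b = limit(1,2,3) f
    show ?case
      using m_lim(2)[OF m b] m_lim(2)[OF m' b] unfolding limit(4) by (rule order_tendsto_unique)
  qed
  have outside: "\<mu> f g = 0" if "is_unit_mult e \<mu>" "\<not> (f \<in> ?E \<and> g \<in> ?E)" for \<mu> f g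
    using that unfolding is_unit_mult_def Let_def by blast
  fix f g
  show "m f g = m' f g"
    using both outside[OF m] outside[OF m'] by (cases "f \<in> ?E \<and> g \<in> ?E") auto
qed

lemma unit_mult_eq_unit_product:
  assumes "0 \<le> e"
  shows "unit_mult e = unit_product e"
  unfolding unit_mult_def
  using is_unit_mult_unit_product[OF assms] is_unit_mult_unique[OF assms] by blast

text \<open>The infimum \<open>h\<close> of the factors has square zero by monotonicity. So all tangents
\<open>2 a h - a\<^sup>2 e\<close> are at most \<open>0\<close>, that is \<open>h \<le> (a / 2) e\<close> for all \<open>a > 0\<close>.\<close>

lemma disjoint_of_unit_product_eq_0:
  fixes e f g :: "'a::dedekind_complete_riesz_space"
  assumes e: "0 \<le> e" and f: "f \<in> bounded_elements e" "0 \<le> f"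
    and g: "g \<in> bounded_elements e" "0 \<le> g" and zero: "unit_product e f g = 0"
  shows "inf f g = 0"
proof (rule antisym)
  define h where "h = inf f g"
  have h0: "0 \<le> h" using f g by (simp add: h_def)
  have h: "h \<in> bounded_elements e"
    using h0 f(2) by (intro bounded_elements_solid[OF f(1)]) (simp add: h_def abs_of_nonneg)
  have "unit_square e h = unit_product e h h" by (rule unit_product_self[OF e h, symmetric])
  also have "\<dots> \<le> unit_product e f g"
    by (intro unit_product_mono e f(1) g(1) h0) (simp_all add: h_def)
  finally have sq: "unit_square e h \<le> 0" by (simp only: zero)
  have "h \<le> (1 / real (Suc n)) *\<^sub>R ((1 / 2) *\<^sub>R e)" for n
  proof -
    define a where "a = 1 / real (Suc n)"
    have a: "0 < a" by (simp add: a_def)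
    have "(2 * a) *\<^sub>R h - (a\<^sup>2) *\<^sub>R e \<le> 0"
      by (rule order_trans[OF unit_square_upper[OF e h] sq])
    moreover have "(a\<^sup>2) *\<^sub>R e = (2 * a) *\<^sub>R (a *\<^sub>R ((1 / 2) *\<^sub>R e))"
      by (simp add: power2_eq_square)
    ultimately have "(2 * a) *\<^sub>R h \<le> (2 * a) *\<^sub>R (a *\<^sub>R ((1 / 2) *\<^sub>R e))" by simp
    moreover have "0 < 2 * a" using a by simp
    ultimately have "h \<le> a *\<^sub>R ((1 / 2) *\<^sub>R e)" by (simp only: scaleR_le_cancel_left_pos)
    thus ?thesis by (simp only: a_def)
  qed
  hence "h \<le> 0" by (rule archimedean_inverse)
  thus "inf f g \<le> 0" by (simp only: h_def)
  show "0 \<le> inf f g" using h0 by (simp only: h_def)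
qed

section \<open>Ergodicity\<close>

lemma strictly_positive_fixed:
  fixes T :: "'a::dedekind_complete_riesz_space \<Rightarrow> 'a"
  assumes T: "strictly_positive T" and idem: "T (T f) = T f" and le: "f \<le> T f"
  shows "T f = f"
proof -
  have lin: "linear T" using T by (simp add: strictly_positive_def positive_operator_def)
  have "T (T f - f) = 0" using linear_diff[OF lin] idem by simp
  hence "T f - f = 0" using T le by (simp add: strictly_positive_def)
  thus ?thesis by simp
qed

text \<open>The part \<open>h\<close> of \<open>p\<close> outside the component \<open>g = T p\<close> has \<open>T h \<le> g \<and> (e - g) = 0\<close>, so it vanishes
by strict positivity. This gives \<open>p \<le> T p\<close>.\<close>

lemma expectation_fixes_component:
  fixes T :: "'a::dedekind_complete_riesz_space \<Rightarrow> 'a"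
  assumes T: "strictly_positive T" and idem: "\<And>f. T (T f) = T f" and Te: "T e = e"
    and p: "component e p" and disj: "inf (T p) (e - T p) = 0"
  shows "T p = p"
proof -
  have lin: "linear T" and pos: "\<And>f. 0 \<le> f \<Longrightarrow> 0 \<le> T f"
    using T by (auto simp: strictly_positive_def positive_operator_def)
  have mono: "T x \<le> T y" if "x \<le> y" for x y
    using pos[of "y - x"] that by (simp add: linear_diff[OF lin])
  define g where "g = T p"
  define h where "h = inf p (e - g)"
  have p0: "0 \<le> p" "p \<le> e" using component_nonneg[OF p] component_le[OF p] by auto
  have g: "0 \<le> g" "g \<le> e" using pos[OF p0(1)] mono[OF p0(2)] Te by (auto simp: g_def)
  have h0: "0 \<le> h" using p0 g by (simp add: h_def)
  have "T h \<le> g" using mono[of h p] by (simp add: h_def g_def)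
  moreover have "T h \<le> e - g"
    using mono[of h "e - g"] by (simp add: h_def linear_diff[OF lin] Te g_def idem)
  ultimately have "T h \<le> inf g (e - g)" by simp
  hence "T h \<le> 0" using disj by (simp only: g_def)
  hence "T h = 0" using pos[OF h0] by (rule antisym)
  hence hz: "h = 0" using T h0 by (simp add: strictly_positive_def)
  have "p = inf p (g + (e - g))" using p0 by (simp add: inf_absorb1)
  also have "\<dots> \<le> inf p g + inf p (e - g)" using p0 g by (intro inf_add_le_add_inf) auto
  also have "\<dots> = inf p g" using hz by (simp add: h_def)
  finally have "p \<le> T p" by (simp add: g_def)
  thus ?thesis by (rule strictly_positive_fixed[OF T idem])
qed

text \<open>Weak mixing is applied to \<open>p\<close> and its complement \<open>e - p\<close>. All terms of the average coincide, as
\<open>p\<close> is invariant, and \<open>p \<cdot> (e - p) = 0\<close> leaves \<open>\<bar>T p \<cdot> (e - T p)\<bar>\<close>.\<close>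

lemma weakly_mixing_fixes_invariant_component:
  fixes T S :: "'a::dedekind_complete_riesz_space \<Rightarrow> 'a"
  assumes sys: "ce_preserving_system T S e" and T: "strictly_positive T"
    and mix: "weakly_mixing T S e" and p: "component e p" and Sp: "S p = p"
  shows "T p = p"
proof (rule expectation_fixes_component[OF T])
  show idem: "T (T f) = T f" for f
    using sys by (simp add: ce_preserving_system_def conditional_expectation_def)
  show Te: "T e = e" using sys by (simp add: ce_preserving_system_def)
  show "component e p" by (rule p)
  have e: "0 \<le> e" by (rule component_unit_nonneg[OF p])
  have lin: "linear T" and pos: "\<And>f. 0 \<le> f \<Longrightarrow> 0 \<le> T f"
    using T by (auto simp: strictly_positive_def positive_operator_def)
  have Tq: "T (e - p) = e - T p" by (simp add: linear_diff[OF lin] Te)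
  have nn: "0 \<le> T p" "0 \<le> e - T p"
    using pos[OF component_nonneg[OF p]] pos[OF component_nonneg[OF component_complement[OF p]]]
    by (simp_all only: Tq)
  have bd: "T p \<in> bounded_elements e" "e - T p \<in> bounded_elements e"
    using nn by (auto intro!: bounded_elements_between)
  obtain P Q where P: "band_projection P" "P e = p" and Q: "band_projection Q" "Q e = e - p"
    using component_band_projection p component_complement[OF p] by metis
  have iter: "(S ^^ k) p = p" for k by (induction k) (simp_all add: Sp)
  have disj: "unit_product e p (e - p) = 0"
    using unit_product_components[OF p component_complement[OF p]] p
    by (simp add: component_def)
  let ?z = "unit_product e (T p) (e - T p)"
  have seq: "(1 / real n) *\<^sub>R (\<Sum>k<n. \<bar>T (unit_mult e ((S ^^ k) (P e)) (Q e)) -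
        unit_mult e (T (P e)) (T (Q e))\<bar>) = \<bar>?z\<bar>" if "0 < n" for n
    using that
    by (simp add: P Q iter Tq unit_mult_eq_unit_product[OF e] disj linear_0[OF lin]
        sum_constant_scaleR)
  have "order_tendsto (\<lambda>n. (1 / real n) *\<^sub>R (\<Sum>k<n. \<bar>T (unit_mult e ((S ^^ k) (P e)) (Q e)) -
        unit_mult e (T (P e)) (T (Q e))\<bar>)) 0"
    using mix P(1) Q(1) by (simp add: weakly_mixing_def)
  moreover have "order_tendsto (\<lambda>n. (1 / real n) *\<^sub>R
        (\<Sum>k<n. \<bar>T (unit_mult e ((S ^^ k) (P e)) (Q e)) -
        unit_mult e (T (P e)) (T (Q e))\<bar>)) \<bar>?z\<bar>"
    using seq by (rule order_tendsto_eventually_const)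
  ultimately have "0 = \<bar>?z\<bar>" by (rule order_tendsto_unique)
  hence "?z = 0" by simp
  thus "inf (T p) (e - T p) = 0"
    by (rule disjoint_of_unit_product_eq_0[OF e bd(1) nn(1) bd(2) nn(2)])
qed

text \<open>Each \<open>n u \<and> e\<close> is invariant, so the image of their supremum is an upper bound of them. Since \<open>T\<close>
takes the same value on the supremum and on its image, strict positivity gives equality.\<close>

lemma invariant_principal_projection:
  fixes T S :: "'a::dedekind_complete_riesz_space \<Rightarrow> 'a"
  assumes sys: "ce_preserving_system T S e" and T: "strictly_positive T"
    and u: "0 \<le> u" "S u = u"
  shows "S (principal_projection u e) = principal_projection u e"
proof -
  let ?p = "principal_projection u e"
  have lin: "linear S" and hom: "\<And>f g. S (inf f g) = inf (S f) (S g)"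
    and Se: "S e = e" and e: "0 \<le> e"
    using sys by (auto simp: ce_preserving_system_def riesz_homomorphism_def weak_order_unit_def)
  have linT: "linear T" using T by (simp add: strictly_positive_def positive_operator_def)
  have le: "?p \<le> S ?p"
  proof (rule principal_projection_least)
    fix n :: nat
    let ?x = "inf (real n *\<^sub>R u) e"
    have inv: "S ?x = ?x" by (simp add: hom linear_scale[OF lin] u Se)
    have "inf ?x ?p = ?x"
      by (rule inf_absorb1) (rule principal_projection_upper)
    hence "S ?x = inf (S ?x) (S ?p)" by (metis hom)
    hence "S ?x \<le> S ?p" by (metis inf_le2)
    thus "?x \<le> S ?p" by (simp only: inv)
  qed
  obtain P where P: "band_projection P" "P e = ?p"
    using component_band_projection[OF component_principal_projection[OF u(1) e]] by blast
  have "T (S ?p) = T ?p" using sys P by (metis ce_preserving_system_def)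
  hence "T (S ?p - ?p) = 0" by (simp add: linear_diff[OF linT])
  hence "S ?p - ?p = 0" using T le by (simp add: strictly_positive_def)
  thus ?thesis by simp
qed

lemma invariant_unit_interval_fixed:
  fixes T S :: "'a::dedekind_complete_riesz_space \<Rightarrow> 'a"
  assumes sys: "ce_preserving_system T S e" and T: "strictly_positive T"
    and mix: "weakly_mixing T S e" and f: "0 \<le> f" "f \<le> e" and Sf: "S f = f"
  shows "T f = f"
proof (rule strictly_positive_fixed[OF T])
  show "T (T f) = T f"
    using sys by (simp add: ce_preserving_system_def conditional_expectation_def)
  have e: "0 \<le> e" using f by (rule order_trans)
  have linS: "linear S" and hom: "\<And>f g. S (sup f g) = sup (S f) (S g)" and Se: "S e = e"
    using sys by (auto simp: ce_preserving_system_def riesz_homomorphism_def)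
  have lin: "linear T" and pos: "\<And>f. 0 \<le> f \<Longrightarrow> 0 \<le> T f"
    using T by (auto simp: strictly_positive_def positive_operator_def)
  have comp: "T (principal_projection (pprt (f - t *\<^sub>R e)) e) = principal_projection (pprt (f - t *\<^sub>R e)) e"
    for t
  proof -
    have u: "0 \<le> pprt (f - t *\<^sub>R e)" by simp
    have "S (pprt (f - t *\<^sub>R e)) = pprt (f - t *\<^sub>R e)"
      by (simp add: pprt_def hom linear_diff[OF linS] linear_scale[OF linS] linear_0[OF linS] Sf Se)
    note invariant_principal_projection[OF sys T u this]
    thus ?thesis
      by (rule weakly_mixing_fixes_invariant_component[OF sys T mix
            component_principal_projection[OF u e]])
  qed
  have step: "T (step_approx e N f) = step_approx e N f" for N
    unfolding step_approx_def by (simp only: linear_scale[OF lin] linear_sum[OF lin] comp)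
  have "f - T f \<le> (1 / real (Suc n)) *\<^sub>R e" for n
  proof -
    let ?s = "step_approx e (Suc n) f"
    have "0 \<le> T (f - ?s)" using step_approx_bounds(1)[OF f, of "Suc n"] by (intro pos) simp
    hence "?s \<le> T f" by (simp add: linear_diff[OF lin] step)
    hence "?s + (1 / real (Suc n)) *\<^sub>R e \<le> T f + (1 / real (Suc n)) *\<^sub>R e"
      by (rule add_right_mono)
    with step_approx_bounds(2)[OF f, of "Suc n"]
    have "f \<le> T f + (1 / real (Suc n)) *\<^sub>R e" by (auto intro: order_trans)
    thus ?thesis by (simp add: diff_le_eq add.commute)
  qed
  hence "f - T f \<le> 0" by (rule archimedean_inverse)
  thus "f \<le> T f" by simp
qed

lemma invariant_nonneg_fixed:
  fixes T S :: "'a::dedekind_complete_riesz_space \<Rightarrow> 'a"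
  assumes sys: "ce_preserving_system T S e" and T: "strictly_positive T"
    and mix: "weakly_mixing T S e" and f: "0 \<le> f" and Sf: "S f = f"
  shows "T f = f"
proof (rule strictly_positive_fixed[OF T])
  show "T (T f) = T f"
    using sys by (simp add: ce_preserving_system_def conditional_expectation_def)
  have linS: "linear S" and hom: "\<And>f g. S (inf f g) = inf (S f) (S g)"
    and Se: "S e = e" and unit: "weak_order_unit e"
    using sys by (auto simp: ce_preserving_system_def riesz_homomorphism_def)
  have e: "0 \<le> e" using unit by (simp add: weak_order_unit_def)
  have lin: "linear T" and pos: "\<And>f. 0 \<le> f \<Longrightarrow> 0 \<le> T f"
    using T by (auto simp: strictly_positive_def positive_operator_def)
  have "f = principal_projection e f"
  proof -
    let ?d = "f - principal_projection e f"
    have "inf \<bar>?d\<bar> e = 0"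
      using principal_projection_rest_disjoint[OF e f] principal_projection_le[of e f] by simp
    hence "?d = 0" using unit unfolding weak_order_unit_def by blast
    thus ?thesis by simp
  qed
  also have "\<dots> \<le> T f"
  proof (rule principal_projection_least)
    fix n :: nat
    \<comment> \<open>The successor makes the factor positive, so that the truncation can be scaled below \<open>e\<close>.\<close>
    define g where "g = inf (real (Suc n) *\<^sub>R e) f"
    define h where "h = (1 / real (Suc n)) *\<^sub>R g"
    have gh: "g = real (Suc n) *\<^sub>R h" by (simp add: h_def del: of_nat_Suc)
    have g: "0 \<le> g" "g \<le> f" "g \<le> real (Suc n) *\<^sub>R e"
      using e f by (auto simp: g_def scaleR_nonneg_nonneg simp del: of_nat_Suc)
    have "0 \<le> h" using g(1) by (simp add: h_def scaleR_nonneg_nonneg)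
    moreover have "h \<le> e"
      using g(3) by (simp only: gh scaleR_le_cancel_left_pos of_nat_0_less_iff zero_less_Suc)
    moreover have "S h = h"
      by (simp add: h_def g_def hom linear_scale[OF linS] Se Sf)
    ultimately have "T h = h" by (rule invariant_unit_interval_fixed[OF sys T mix])
    hence "T g = g" by (simp only: gh linear_scale[OF lin])
    moreover have "0 \<le> T (f - g)" using g(2) by (intro pos) simp
    ultimately have "g \<le> T f" by (simp add: linear_diff[OF lin])
    moreover have "inf (real n *\<^sub>R e) f \<le> g"
      unfolding g_def using e by (intro inf_mono scaleR_right_mono) auto
    ultimately show "inf (real n *\<^sub>R e) f \<le> T f" by (rule order_trans[rotated])
  qed
  finally show "f \<le> T f" .
qed

lemma ergodic_limit_invariant:
  fixes S :: "'a::dedekind_complete_riesz_space \<Rightarrow> 'a"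
  assumes "S f = f"
  shows "ergodic_limit S f = f"
proof -
  have iter: "(S ^^ k) f = f" for k by (induction k) (simp_all add: assms)
  have "order_tendsto (\<lambda>n. cesaro_mean S n f) f"
    by (rule order_tendsto_eventually_const)
      (simp add: cesaro_mean_def iter sum_constant_scaleR)
  thus ?thesis
    unfolding ergodic_limit_def by (auto intro: order_tendsto_unique)
qed

theorem corollary4p2:
  fixes T S :: "'a::dedekind_complete_riesz_space \<Rightarrow> 'a"
    and e :: 'a
  assumes "ce_preserving_system T S e"
    and "strictly_positive T"
    and "weakly_mixing T S e"
  shows "ergodic T S"
  unfolding ergodic_def
proof
  fix f assume "f \<in> invariant_set S"
  hence Sf: "S f = f" by (simp add: invariant_set_def)
  have linS: "linear S" and hom: "\<And>f g. S (sup f g) = sup (S f) (S g)"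
    using assms(1) by (auto simp: ce_preserving_system_def riesz_homomorphism_def)
  have lin: "linear T"
    using assms(2) by (simp add: strictly_positive_def positive_operator_def)
  have "S (pprt g) = pprt g" if "S g = g" for g
    using that by (simp add: pprt_def hom linear_0[OF linS])
  hence fixed: "T (pprt g) = pprt g" if "S g = g" for g
    using that by (intro invariant_nonneg_fixed[OF assms]) auto
  have "f = pprt f - pprt (- f)" using prts[of f] by (simp add: pprt_neg)
  moreover have "T (pprt f - pprt (- f)) = pprt f - pprt (- f)"
    using fixed[of f] fixed[of "- f"] Sf by (simp add: linear_diff[OF lin] linear_neg[OF linS])
  ultimately have "T f = f" by simp
  hence "f \<in> range T" by (metis rangeI)
  moreover have "ergodic_limit S f = f" using Sf by (rule ergodic_limit_invariant)
  ultimately show "ergodic_limit S f \<in> range T" by simp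
qed

end
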